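(* Let $n\ge 6$ be an integer, let $\alpha\ge 0$, $\Lambda\neq 0$ and $r_0>0$ be real numbers, and let $k\in\{1,-1\}$. Let $(\mathcal{M}^4,g_{AB})$ be an arbitrary four-dimensional Lorentzian manifold, let $(\mathcal{K}^{n-4},\gamma_{ab})$ be an $(n-4)$-dimensional Riemannian space of constant sectional curvature $k$, and consider the $n$-dimensional spacetime $\mathcal{M}^4\times\mathcal{K}^{n-4}$ with the product metric $g_{\mu\nu}=\mathrm{diag}(g_{AB},\,r_0^2\gamma_{ab})$. Suppose that (i) $r_0^2=-2k\alpha(n-4)(n-5)$, and (ii) $\alpha\Lambda=-\dfrac{n^2-5n-2}{8(n-4)(n-5)}$. Then the four-dimensional components of the Einstein-Gauss-Bonnet tensor with cosmological constant vanish identically: $\mathcal{G}^A{}_B=0$ for all indices $A,B$ tangent to $\mathcal{M}^4$.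
   Context: On an $n$-dimensional pseudo-Riemannian manifold with metric $g_{\mu\nu}$, define $$\mathcal{G}^\mu{}_\nu = G^\mu{}_\nu+\alpha H^\mu{}_\nu+\Lambda\,\delta^\mu{}_\nu,$$ where $G_{\mu\nu}=R_{\mu\nu}-\frac12 g_{\mu\nu}R$, $$H_{\mu\nu}=2\left[RR_{\mu\nu}-2R_{\mu\alpha}R^\alpha{}_\nu-2R^{\alpha\beta}R_{\mu\alpha\nu\beta}+R_\mu{}^{\alpha\beta\gamma}R_{\nu\alpha\beta\gamma}\right]-\frac12 g_{\mu\nu}L_{GB},$$ $$L_{GB}=R^2-4R_{\mu\nu}R^{\mu\nu}+R_{\mu\nu\rho\sigma}R^{\mu\nu\rho\sigma},$$ and $R_{\mu\nu\rho\sigma}$, $R_{\mu\nu}=R^\alpha{}_{\mu\alpha\nu}$, $R$ are the Riemann tensor, Ricci tensor and Ricci scalar of the $n$-dimensional metric (with signs such that round spheres have positive Ricci scalar). The real number $\alpha$ is the Gauss-Bonnet coupling constant and $\Lambda$ the cosmological constant. Indices $A,B\in\{0,1,2,3\}$ refer to $\mathcal{M}^4$; indices $a,b\in\{4,\dots,n-1\}$ refer to $\mathcal{K}^{n-4}$; $\mu,\nu$ run over all $n$ indices. *)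

theory Defs
  imports "HOL-Analysis.Analysis"
begin

section \<open>Partial derivatives and smooth functions on open subsets of \<open>\<real>\<^sup>d\<close>\<close>

definition partial :: "'d::finite \<Rightarrow> (real^'d \<Rightarrow> real) \<Rightarrow> real^'d \<Rightarrow> real" where
  "partial i f x = frechet_derivative f (at x) (axis i 1)"

fun Ck_on :: "nat \<Rightarrow> (real^'d::finite) set \<Rightarrow> (real^'d \<Rightarrow> real) \<Rightarrow> bool" where
  "Ck_on 0 S f \<longleftrightarrow> continuous_on S f"
| "Ck_on (Suc k) S f \<longleftrightarrow> (\<forall>x\<in>S. f differentiable (at x)) \<and> (\<forall>i. Ck_on k S (partial i f))"

definition smooth_on :: "(real^'d::finite) set \<Rightarrow> (real^'d \<Rightarrow> real) \<Rightarrow> bool" where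
  "smooth_on S f \<longleftrightarrow> (\<forall>k. Ck_on k S f)"


section \<open>Curvature of a metric given by its components in a coordinate system\<close>

text \<open>
  Here \<open>g x $ a $ b\<close> is the component \<open>g\<^sub>a\<^sub>b\<close> at the coordinate point \<open>x\<close>.
  Suffixes \<open>u\<close> and \<open>d\<close> give the position (up, down) of the indices.
\<close>

definition inv_metric :: "(real^'d::finite \<Rightarrow> real^'d^'d) \<Rightarrow> real^'d \<Rightarrow> 'd \<Rightarrow> 'd \<Rightarrow> real" where
  "inv_metric g x a b = matrix_inv (g x) $ a $ b"

definition christoffel ::
    "(real^'d::finite \<Rightarrow> real^'d^'d) \<Rightarrow> real^'d \<Rightarrow> 'd \<Rightarrow> 'd \<Rightarrow> 'd \<Rightarrow> real" where
  "christoffel g x a b c = (1/2) * (\<Sum>e\<in>UNIV. inv_metric g x a e *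
     (partial b (\<lambda>y. g y $ e $ c) x + partial c (\<lambda>y. g y $ e $ b) x - partial e (\<lambda>y. g y $ b $ c) x))"

text \<open>
  \<open>R\<^sup>a\<^sub>b\<^sub>c\<^sub>d = \<partial>\<^sub>c \<Gamma>\<^sup>a\<^sub>d\<^sub>b - \<partial>\<^sub>d \<Gamma>\<^sup>a\<^sub>c\<^sub>b + \<Gamma>\<^sup>a\<^sub>c\<^sub>e \<Gamma>\<^sup>e\<^sub>d\<^sub>b - \<Gamma>\<^sup>a\<^sub>d\<^sub>e \<Gamma>\<^sup>e\<^sub>c\<^sub>b\<close>. With this sign, and
  \<open>R\<^sub>b\<^sub>d = R\<^sup>a\<^sub>b\<^sub>a\<^sub>d\<close> below, round spheres have positive scalar curvature.
\<close>

definition riemann_uddd ::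
    "(real^'d::finite \<Rightarrow> real^'d^'d) \<Rightarrow> real^'d \<Rightarrow> 'd \<Rightarrow> 'd \<Rightarrow> 'd \<Rightarrow> 'd \<Rightarrow> real" where
  "riemann_uddd g x a b c d =
     partial c (\<lambda>y. christoffel g y a d b) x - partial d (\<lambda>y. christoffel g y a c b) x
     + (\<Sum>e\<in>UNIV. christoffel g x a c e * christoffel g x e d b
                - christoffel g x a d e * christoffel g x e c b)"

definition riemann_dddd ::
    "(real^'d::finite \<Rightarrow> real^'d^'d) \<Rightarrow> real^'d \<Rightarrow> 'd \<Rightarrow> 'd \<Rightarrow> 'd \<Rightarrow> 'd \<Rightarrow> real" where
  "riemann_dddd g x a b c d = (\<Sum>e\<in>UNIV. g x $ a $ e * riemann_uddd g x e b c d)"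

definition riemann_duuu ::
    "(real^'d::finite \<Rightarrow> real^'d^'d) \<Rightarrow> real^'d \<Rightarrow> 'd \<Rightarrow> 'd \<Rightarrow> 'd \<Rightarrow> 'd \<Rightarrow> real" where
  "riemann_duuu g x a b c d = (\<Sum>p\<in>UNIV. \<Sum>q\<in>UNIV. \<Sum>r\<in>UNIV.
     inv_metric g x b p * inv_metric g x c q * inv_metric g x d r * riemann_dddd g x a p q r)"

definition riemann_uuuu ::
    "(real^'d::finite \<Rightarrow> real^'d^'d) \<Rightarrow> real^'d \<Rightarrow> 'd \<Rightarrow> 'd \<Rightarrow> 'd \<Rightarrow> 'd \<Rightarrow> real" where
  "riemann_uuuu g x a b c d = (\<Sum>e\<in>UNIV. inv_metric g x a e * riemann_duuu g x e b c d)"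

definition ricci_dd :: "(real^'d::finite \<Rightarrow> real^'d^'d) \<Rightarrow> real^'d \<Rightarrow> 'd \<Rightarrow> 'd \<Rightarrow> real" where
  "ricci_dd g x a b = (\<Sum>c\<in>UNIV. riemann_uddd g x c a c b)"

definition ricci_ud :: "(real^'d::finite \<Rightarrow> real^'d^'d) \<Rightarrow> real^'d \<Rightarrow> 'd \<Rightarrow> 'd \<Rightarrow> real" where
  "ricci_ud g x a b = (\<Sum>c\<in>UNIV. inv_metric g x a c * ricci_dd g x c b)"

definition ricci_uu :: "(real^'d::finite \<Rightarrow> real^'d^'d) \<Rightarrow> real^'d \<Rightarrow> 'd \<Rightarrow> 'd \<Rightarrow> real" where
  "ricci_uu g x a b = (\<Sum>c\<in>UNIV. inv_metric g x b c * ricci_ud g x a c)"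

definition scalar_curv :: "(real^'d::finite \<Rightarrow> real^'d^'d) \<Rightarrow> real^'d \<Rightarrow> real" where
  "scalar_curv g x = (\<Sum>a\<in>UNIV. ricci_ud g x a a)"

definition einstein_dd :: "(real^'d::finite \<Rightarrow> real^'d^'d) \<Rightarrow> real^'d \<Rightarrow> 'd \<Rightarrow> 'd \<Rightarrow> real" where
  "einstein_dd g x a b = ricci_dd g x a b - (1/2) * g x $ a $ b * scalar_curv g x"

definition L_GB :: "(real^'d::finite \<Rightarrow> real^'d^'d) \<Rightarrow> real^'d \<Rightarrow> real" where
  "L_GB g x = (scalar_curv g x)\<^sup>2
     - 4 * (\<Sum>a\<in>UNIV. \<Sum>b\<in>UNIV. ricci_dd g x a b * ricci_uu g x a b)
     + (\<Sum>a\<in>UNIV. \<Sum>b\<in>UNIV. \<Sum>c\<in>UNIV. \<Sum>d\<in>UNIV.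
          riemann_dddd g x a b c d * riemann_uuuu g x a b c d)"

definition gauss_bonnet_dd :: "(real^'d::finite \<Rightarrow> real^'d^'d) \<Rightarrow> real^'d \<Rightarrow> 'd \<Rightarrow> 'd \<Rightarrow> real" where
  "gauss_bonnet_dd g x m n =
     2 * (scalar_curv g x * ricci_dd g x m n
          - 2 * (\<Sum>a\<in>UNIV. ricci_dd g x m a * ricci_ud g x a n)
          - 2 * (\<Sum>a\<in>UNIV. \<Sum>b\<in>UNIV. ricci_uu g x a b * riemann_dddd g x m a n b)
          + (\<Sum>a\<in>UNIV. \<Sum>b\<in>UNIV. \<Sum>c\<in>UNIV.
               riemann_duuu g x m a b c * riemann_dddd g x n a b c))
     - (1/2) * g x $ m $ n * L_GB g x"

definition egb_ud ::
    "real \<Rightarrow> real \<Rightarrow> (real^'d::finite \<Rightarrow> real^'d^'d) \<Rightarrow> real^'d \<Rightarrow> 'd \<Rightarrow> 'd \<Rightarrow> real" where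
  "egb_ud \<alpha> \<Lambda> g x m n =
     (\<Sum>r\<in>UNIV. inv_metric g x m r * einstein_dd g x r n)
     + \<alpha> * (\<Sum>r\<in>UNIV. inv_metric g x m r * gauss_bonnet_dd g x r n)
     + \<Lambda> * (if m = n then 1 else 0)"

definition sectional_curv ::
    "(real^'d::finite \<Rightarrow> real^'d^'d) \<Rightarrow> real^'d \<Rightarrow> real^'d \<Rightarrow> real^'d \<Rightarrow> real" where
  "sectional_curv g x u v =
     (\<Sum>a\<in>UNIV. \<Sum>b\<in>UNIV. \<Sum>c\<in>UNIV. \<Sum>d\<in>UNIV.
        riemann_dddd g x a b c d * u $ a * v $ b * u $ c * v $ d)
     / ((u \<bullet> (g x *v u)) * (v \<bullet> (g x *v v)) - (u \<bullet> (g x *v v))\<^sup>2)"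


section \<open>Manifolds with a metric\<close>

text \<open>
  A manifold of dimension \<open>CARD('d)\<close> on the topological space \<open>mtop M\<close>, with an atlas of charts
  indexed by \<open>charts M\<close>. Chart \<open>i\<close> is the map \<open>coord M i\<close> on \<open>cdom M i\<close>, and
  \<open>gmat M i x\<close> is the component matrix of the metric in this chart at the coordinate point \<open>x\<close>
  (only its values on \<open>cimage M i\<close> matter).
\<close>

record ('i, 'm, 'd) metric_manifold =
  mtop :: "'m topology"
  charts :: "'i set"
  cdom :: "'i \<Rightarrow> 'm set"
  coord :: "'i \<Rightarrow> 'm \<Rightarrow> real^'d"
  gmat :: "'i \<Rightarrow> real^'d \<Rightarrow> real^'d^'d"

definition cimage :: "('i, 'm, 'd::finite) metric_manifold \<Rightarrow> 'i \<Rightarrow> (real^'d) set" where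
  "cimage M i = coord M i ` cdom M i"

definition transition ::
    "('i, 'm, 'd::finite) metric_manifold \<Rightarrow> 'i \<Rightarrow> 'i \<Rightarrow> real^'d \<Rightarrow> real^'d" where
  "transition M i j = coord M j \<circ> inv_into (cdom M i) (coord M i)"

definition overlap :: "('i, 'm, 'd::finite) metric_manifold \<Rightarrow> 'i \<Rightarrow> 'i \<Rightarrow> (real^'d) set" where
  "overlap M i j = coord M i ` (cdom M i \<inter> cdom M j)"

definition smooth_manifold :: "('i, 'm, 'd::finite) metric_manifold \<Rightarrow> bool" where
  "smooth_manifold M \<longleftrightarrow>
     Hausdorff_space (mtop M) \<and> second_countable (mtop M) \<and>
     (\<Union>i\<in>charts M. cdom M i) = topspace (mtop M) \<and>
     (\<forall>i\<in>charts M. openin (mtop M) (cdom M i) \<and> open (cimage M i) \<and>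
        homeomorphic_map (subtopology (mtop M) (cdom M i)) (top_of_set (cimage M i)) (coord M i)) \<and>
     (\<forall>i\<in>charts M. \<forall>j\<in>charts M. \<forall>a. smooth_on (overlap M i j) (\<lambda>x. transition M i j x $ a))"

text \<open>Smooth symmetric covariant 2-tensor field, given by its components in each chart.\<close>

definition symmetric_tensor_field :: "('i, 'm, 'd::finite) metric_manifold \<Rightarrow> bool" where
  "symmetric_tensor_field M \<longleftrightarrow>
     (\<forall>i\<in>charts M. (\<forall>a b. smooth_on (cimage M i) (\<lambda>x. gmat M i x $ a $ b)) \<and>
        (\<forall>x\<in>cimage M i. transpose (gmat M i x) = gmat M i x)) \<and>
     (\<forall>i\<in>charts M. \<forall>j\<in>charts M. \<forall>x\<in>overlap M i j.
        gmat M i x = transpose (jacobian (transition M i j) (at x)) **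
          gmat M j (transition M i j x) ** jacobian (transition M i j) (at x))"

text \<open>
  Signature \<open>(-,+,\<dots>,+)\<close>: there is an orthonormal basis with exactly one timelike vector.
  (Vectors satisfying these relations are automatically linearly independent.)
\<close>

definition lorentzian_form :: "real^'d^'d::finite \<Rightarrow> bool" where
  "lorentzian_form h \<longleftrightarrow> (\<exists>(e::'d \<Rightarrow> real^'d) t. \<forall>i j.
     e i \<bullet> (h *v e j) = (if i = j then (if i = t then - 1 else 1) else 0))"

definition lorentzian_manifold :: "('i, 'm, 'd::finite) metric_manifold \<Rightarrow> bool" where
  "lorentzian_manifold M \<longleftrightarrow> smooth_manifold M \<and> symmetric_tensor_field M \<and>
     (\<forall>i\<in>charts M. \<forall>x\<in>cimage M i. lorentzian_form (gmat M i x))"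

definition riemannian_manifold :: "('i, 'm, 'd::finite) metric_manifold \<Rightarrow> bool" where
  "riemannian_manifold M \<longleftrightarrow> smooth_manifold M \<and> symmetric_tensor_field M \<and>
     (\<forall>i\<in>charts M. \<forall>x\<in>cimage M i. \<forall>v. v \<noteq> 0 \<longrightarrow> v \<bullet> (gmat M i x *v v) > 0)"

text \<open>
  Linear independence of the pair \<open>u\<close>, \<open>v\<close> is stated with \<open>u \<noteq> v\<close>, since \<open>independent {u, v}\<close>
  refers to the set only.
\<close>

definition constant_sectional_curvature ::
    "('i, 'm, 'd::finite) metric_manifold \<Rightarrow> real \<Rightarrow> bool" where
  "constant_sectional_curvature M k \<longleftrightarrow>
     (\<forall>i\<in>charts M. \<forall>x\<in>cimage M i. \<forall>u v. u \<noteq> v \<and> independent {u, v} \<longrightarrow>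
        sectional_curv (gmat M i) x u v = k)"

text \<open>
  The product of \<open>M\<close> and \<open>K\<close> with the product atlas and the block-diagonal metric
  \<open>diag(g, r\<^sup>2 \<gamma>)\<close>. Coordinate indices of the product are \<open>Inl A\<close> (along \<open>M\<close>) and \<open>Inr a\<close>
  (along \<open>K\<close>).
\<close>

definition product_manifold ::
    "real \<Rightarrow> ('i, 'm, 'c::finite) metric_manifold \<Rightarrow> ('j, 'n, 'd::finite) metric_manifold \<Rightarrow>
     ('i \<times> 'j, 'm \<times> 'n, 'c + 'd) metric_manifold" where
  "product_manifold r M K = \<lparr>
     mtop = prod_topology (mtop M) (mtop K),
     charts = charts M \<times> charts K,
     cdom = (\<lambda>(i, j). cdom M i \<times> cdom K j),
     coord = (\<lambda>(i, j) (p, q). \<chi> \<mu>. case \<mu> of Inl A \<Rightarrow> coord M i p $ A | Inr a \<Rightarrow> coord K j q $ a),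
     gmat = (\<lambda>(i, j) x. \<chi> \<mu> \<nu>.
       (case \<mu> of
          Inl A \<Rightarrow> (case \<nu> of Inl B \<Rightarrow> gmat M i (\<chi> C. x $ Inl C) $ A $ B | Inr b \<Rightarrow> 0)
        | Inr a \<Rightarrow> (case \<nu> of Inl B \<Rightarrow> 0 | Inr b \<Rightarrow> r\<^sup>2 * gmat K j (\<chi> c. x $ Inr c) $ a $ b)))\<rparr>"

text \<open>The mixed components of the Einstein-Gauss-Bonnet tensor in chart \<open>i\<close> at the point \<open>p\<close>.\<close>

definition egb_tensor ::
    "real \<Rightarrow> real \<Rightarrow> ('i, 'm, 'd::finite) metric_manifold \<Rightarrow> 'i \<Rightarrow> 'm \<Rightarrow> 'd \<Rightarrow> 'd \<Rightarrow> real" where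
  "egb_tensor \<alpha> \<Lambda> M i p m n = egb_ud \<alpha> \<Lambda> (gmat M i) (coord M i p) m n"

end

theory Submission
  imports Defs
begin

text \<open>
  In terms of the mixed Riemann tensor \<open>R\<^sup>a\<^sup>b\<^sub>c\<^sub>d\<close> the Gauss-Bonnet tensor is a quadratic expression
  without any metric, and it is a contraction of an antisymmetrisation over five indices, so it
  vanishes identically in dimension four. The mixed Riemann tensor of the product metric is the
  direct sum of the one of \<open>M\<close> and the one of \<open>K\<close> divided by \<open>r0\<^sup>2\<close>, and the latter is
  \<open>\<kappa> (\<delta>\<^sup>a\<^sub>c \<delta>\<^sup>b\<^sub>d - \<delta>\<^sup>a\<^sub>d \<delta>\<^sup>b\<^sub>c)\<close> with \<open>\<kappa> = k / r0\<^sup>2\<close>. If \<open>s\<close> and \<open>L\<close> are the scalar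
  curvature and Gauss-Bonnet scalar of this second summand, the \<open>M\<close>-components of the field equations
  therefore reduce to \<open>(1 + 2 \<alpha> s) G\<^sup>A\<^sub>B + (\<Lambda> - s / 2 - \<alpha> L / 2) \<delta>\<^sup>A\<^sub>B\<close>, and the two
  hypotheses on \<open>r0\<close> and \<open>\<Lambda>\<close> say that both coefficients are zero.
\<close>

section \<open>Mixed curvature tensors\<close>

definition contr :: "('a::finite \<Rightarrow> 'a \<Rightarrow> 'a \<Rightarrow> 'a \<Rightarrow> real) \<Rightarrow> 'a \<Rightarrow> 'a \<Rightarrow> real" where
  "contr X a b = (\<Sum>c\<in>UNIV. X c a c b)"

definition scal :: "('a::finite \<Rightarrow> 'a \<Rightarrow> 'a \<Rightarrow> 'a \<Rightarrow> real) \<Rightarrow> real" where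
  "scal X = (\<Sum>a\<in>UNIV. contr X a a)"

definition gb_scalar :: "('a::finite \<Rightarrow> 'a \<Rightarrow> 'a \<Rightarrow> 'a \<Rightarrow> real) \<Rightarrow> real" where
  "gb_scalar X = (scal X)\<^sup>2 - 4 * (\<Sum>a\<in>UNIV. \<Sum>b\<in>UNIV. contr X a b * contr X b a)
     + (\<Sum>a\<in>UNIV. \<Sum>b\<in>UNIV. \<Sum>c\<in>UNIV. \<Sum>d\<in>UNIV. X a b c d * X c d a b)"

definition gb_tensor :: "('a::finite \<Rightarrow> 'a \<Rightarrow> 'a \<Rightarrow> 'a \<Rightarrow> real) \<Rightarrow> 'a \<Rightarrow> 'a \<Rightarrow> real" where
  "gb_tensor X m n = 2 * (scal X * contr X m n - 2 * (\<Sum>a\<in>UNIV. contr X m a * contr X a n)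
     - 2 * (\<Sum>a\<in>UNIV. \<Sum>b\<in>UNIV. X m a n b * contr X b a)
     + (\<Sum>a\<in>UNIV. \<Sum>b\<in>UNIV. \<Sum>c\<in>UNIV. X m a b c * X b c n a))
     - (1/2) * (if m = n then 1 else 0) * gb_scalar X"

lemma gb_tensor_dim4:
  fixes X :: "4 \<Rightarrow> 4 \<Rightarrow> 4 \<Rightarrow> 4 \<Rightarrow> real"
  assumes up: "\<And>a b c d. X b a c d = - X a b c d"
    and down: "\<And>a b c d. X a b d c = - X a b c d"
  shows "gb_tensor X m n = 0"
proof -
  have zu: "X a a c d = 0" for a c d using up[of a a c d] by simp
  have zd: "X a b c c = 0" for a b c using down[of a b c c] by simp
  \<comment> \<open>Antisymmetry in both pairs leaves the 36 values of \<open>X\<close> whose two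
    pairs are increasing. Rewriting every other value to one of these, up to sign, or to zero turns
    each component into a polynomial identity.\<close>
  note ups = up[of 2 1] up[of 3 1] up[of 4 1] up[of 3 2] up[of 4 2] up[of 4 3]
  note downs = down[of _ _ 2 1] down[of _ _ 3 1] down[of _ _ 4 1] down[of _ _ 3 2] down[of _ _ 4 2] down[of _ _ 4 3]
  have "\<forall>m n. gb_tensor X m n = 0"
    unfolding forall_4 gb_tensor_def gb_scalar_def contr_def scal_def
    by (simp only: sum_4 zu zd, simp only: ups downs, simp add: zu zd, intro conjI; algebra)
  thus ?thesis by blast
qed

section \<open>Gauss-Bonnet expressions of a direct sum of curvature tensors\<close>

lemma sum_UNIV_Plus:
  fixes f :: "'c::finite + 'd::finite \<Rightarrow> 'a::comm_monoid_add"
  shows "(\<Sum>a\<in>UNIV. f a) = (\<Sum>i\<in>UNIV. f (Inl i)) + (\<Sum>j\<in>UNIV. f (Inr j))"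
  unfolding UNIV_Plus_UNIV[symmetric] by (subst sum.Plus) auto

definition direct_sum ::
  "('c \<Rightarrow> 'c \<Rightarrow> 'c \<Rightarrow> 'c \<Rightarrow> real) \<Rightarrow> ('d \<Rightarrow> 'd \<Rightarrow> 'd \<Rightarrow> 'd \<Rightarrow> real) \<Rightarrow>
     'c + 'd \<Rightarrow> 'c + 'd \<Rightarrow> 'c + 'd \<Rightarrow> 'c + 'd \<Rightarrow> real" where
  "direct_sum X Y a b c d = (case (a, b, c, d) of
      (Inl i, Inl j, Inl k, Inl l) \<Rightarrow> X i j k l
    | (Inr i, Inr j, Inr k, Inr l) \<Rightarrow> Y i j k l
    | _ \<Rightarrow> 0)"

lemma direct_sum_antisym:
  assumes "\<And>a b c d. X b a c d = - X a b c d" "\<And>a b c d. Y b a c d = - Y a b c d"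
  shows "direct_sum X Y b a c d = - direct_sum X Y a b c d"
  by (cases a; cases b; cases c; cases d) (auto simp: direct_sum_def intro: assms)

lemma direct_sum_pair_sym:
  assumes "\<And>a b c d. X a b c d = X c d a b" "\<And>a b c d. Y a b c d = Y c d a b"
  shows "direct_sum X Y a b c d = direct_sum X Y c d a b"
  by (cases a; cases b; cases c; cases d) (auto simp: direct_sum_def intro: assms)

lemma contr_direct_sum [simp]:
  "contr (direct_sum X Y) (Inl i) (Inl j) = contr X i j"
  "contr (direct_sum X Y) (Inl i) (Inr b) = 0"
  "contr (direct_sum X Y) (Inr a) (Inl j) = 0"
  "contr (direct_sum X Y) (Inr a) (Inr b) = contr Y a b"
  by (simp_all add: contr_def sum_UNIV_Plus direct_sum_def)

lemma scal_direct_sum: "scal (direct_sum X Y) = scal X + scal Y"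
  by (simp add: scal_def sum_UNIV_Plus)

lemma gb_scalar_direct_sum:
  "gb_scalar (direct_sum X Y) = gb_scalar X + gb_scalar Y + 2 * scal X * scal Y"
proof -
  have "(\<Sum>a\<in>UNIV. \<Sum>b\<in>UNIV. \<Sum>c\<in>UNIV. \<Sum>d\<in>UNIV. direct_sum X Y a b c d * direct_sum X Y c d a b)
    = (\<Sum>a\<in>UNIV. \<Sum>b\<in>UNIV. \<Sum>c\<in>UNIV. \<Sum>d\<in>UNIV. X a b c d * X c d a b)
     + (\<Sum>a\<in>UNIV. \<Sum>b\<in>UNIV. \<Sum>c\<in>UNIV. \<Sum>d\<in>UNIV. Y a b c d * Y c d a b)"
    by (simp add: sum_UNIV_Plus direct_sum_def)
  thus ?thesis
    unfolding gb_scalar_def scal_direct_sum by (simp add: sum_UNIV_Plus power2_sum algebra_simps)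
qed

text \<open>Free indices in the first block confine every contraction chain attached to them to that
  block. The summands meet only through factors that are complete traces: \<open>scal\<close> in the
  first term, and the cross term of \<open>scal\<close> squared inside
  \<open>gb_scalar\<close>.\<close>

lemma gb_tensor_direct_sum:
  "gb_tensor (direct_sum X Y) (Inl m) (Inl n) = gb_tensor X m n + 2 * scal Y * contr X m n
    - (1/2) * (if m = n then 1 else 0) * (gb_scalar Y + 2 * scal X * scal Y)"
proof -
  have "(\<Sum>a\<in>UNIV. \<Sum>b\<in>UNIV. \<Sum>c\<in>UNIV. direct_sum X Y (Inl m) a b c * direct_sum X Y b c (Inl n) a)
    = (\<Sum>a\<in>UNIV. \<Sum>b\<in>UNIV. \<Sum>c\<in>UNIV. X m a b c * X b c n a)"
   and "(\<Sum>a\<in>UNIV. \<Sum>b\<in>UNIV. direct_sum X Y (Inl m) a (Inl n) b * contr (direct_sum X Y) b a)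
    = (\<Sum>a\<in>UNIV. \<Sum>b\<in>UNIV. X m a n b * contr X b a)"
   and "(\<Sum>a\<in>UNIV. contr (direct_sum X Y) (Inl m) a * contr (direct_sum X Y) a (Inl n))
    = (\<Sum>a\<in>UNIV. contr X m a * contr X a n)"
    by (simp_all add: sum_UNIV_Plus direct_sum_def)
  thus ?thesis
    unfolding gb_tensor_def scal_direct_sum gb_scalar_direct_sum by (simp add: algebra_simps)
qed

section \<open>The model tensor of constant curvature\<close>

definition const_curv :: "real \<Rightarrow> 'a \<Rightarrow> 'a \<Rightarrow> 'a \<Rightarrow> 'a \<Rightarrow> real" where
  "const_curv k a b c d = k * (of_bool (a = c) * of_bool (b = d) - of_bool (a = d) * of_bool (b = c))"

lemma sum_of_bool_mult [simp]:
  fixes f :: "'a::finite \<Rightarrow> real"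
  shows "(\<Sum>a\<in>UNIV. of_bool (a = c) * f a) = f c" "(\<Sum>a\<in>UNIV. of_bool (c = a) * f a) = f c"
  by (simp_all add: of_bool_def if_distrib[of "\<lambda>x. x * _"] cong: if_cong)

text \<open>The two products of deltas select the index pairs \<open>(a, b)\<close> and
  \<open>(b, a)\<close>. With \<open>F\<close> taken from the model tensor itself, this evaluates
  its square.\<close>

lemma contract_const_curv:
  fixes F :: "'a::finite \<Rightarrow> 'a \<Rightarrow> real"
  shows "(\<Sum>c\<in>UNIV. \<Sum>d\<in>UNIV. const_curv k a b c d * F c d) = k * (F a b - F b a)"
proof -
  have "(\<Sum>c\<in>UNIV. \<Sum>d\<in>UNIV. const_curv k a b c d * F c d)
    = k * ((\<Sum>c\<in>UNIV. of_bool (a = c) * (\<Sum>d\<in>UNIV. of_bool (b = d) * F c d))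
      - (\<Sum>c\<in>UNIV. of_bool (b = c) * (\<Sum>d\<in>UNIV. of_bool (a = d) * F c d)))"
    unfolding const_curv_def sum_distrib_left sum_subtractf[symmetric] right_diff_distrib
    by (intro sum.cong refl) (simp add: algebra_simps)
  thus ?thesis by simp
qed

lemma contr_const_curv:
  "contr (const_curv k :: 'a::finite \<Rightarrow> _) a b = k * (real CARD('a) - 1) * of_bool (a = b)"
proof -
  have "contr (const_curv k :: 'a \<Rightarrow> _) a b
    = (\<Sum>c\<in>UNIV. k * of_bool (a = b) - of_bool (c = b) * (k * of_bool (a = c)))"
    unfolding contr_def const_curv_def by (simp add: right_diff_distrib mult.left_commute)
  also have "\<dots> = k * (real CARD('a) - 1) * of_bool (a = b)"
    unfolding sum_subtractf sum_of_bool_mult by (simp add: algebra_simps)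
  finally show ?thesis .
qed

lemma scal_const_curv:
  "scal (const_curv k :: 'a::finite \<Rightarrow> _) = k * real CARD('a) * (real CARD('a) - 1)"
  unfolding scal_def contr_const_curv by simp

text \<open>With \<open>d\<close> the dimension, the three terms are \<open>k^2 d (d - 1)\<close>
  times \<open>d (d - 1)\<close>, \<open>- 4 (d - 1)\<close> and \<open>2\<close>, and these factors
  add up to \<open>(d - 2) (d - 3)\<close>.\<close>

lemma gb_scalar_const_curv:
  "gb_scalar (const_curv k :: 'a::finite \<Rightarrow> _)
    = k\<^sup>2 * real CARD('a) * (real CARD('a) - 1) * (real CARD('a) - 2) * (real CARD('a) - 3)"
proof -
  let ?X = "const_curv k :: 'a \<Rightarrow> _"
  let ?d = "real CARD('a)"
  have "(\<Sum>c\<in>UNIV. \<Sum>d\<in>UNIV. ?X a b c d * ?X c d a b) = 2 * k * ?X a b a b" for a b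
    unfolding contract_const_curv[of k a b "\<lambda>c d. ?X c d a b"]
    by (simp add: const_curv_def algebra_simps)
  hence "(\<Sum>a\<in>UNIV. \<Sum>b\<in>UNIV. \<Sum>c\<in>UNIV. \<Sum>d\<in>UNIV. ?X a b c d * ?X c d a b)
     = 2 * k * (\<Sum>a\<in>UNIV. \<Sum>b\<in>UNIV. ?X a b a b)"
    by (simp add: sum_distrib_left)
  also have "(\<Sum>a\<in>UNIV. \<Sum>b\<in>UNIV. ?X a b a b) = scal ?X"
    unfolding scal_def contr_def by (rule sum.swap)
  finally have riem: "(\<Sum>a\<in>UNIV. \<Sum>b\<in>UNIV. \<Sum>c\<in>UNIV. \<Sum>d\<in>UNIV. ?X a b c d * ?X c d a b) = 2 * k * scal ?X" .
  have "(\<Sum>b\<in>UNIV. contr ?X a b * contr ?X b a) = (k * (?d - 1))\<^sup>2" for a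
  proof -
    have "(\<Sum>b\<in>UNIV. contr ?X a b * contr ?X b a) = (\<Sum>b\<in>UNIV. of_bool (a = b) * (k * (?d - 1))\<^sup>2)"
      unfolding contr_const_curv by (intro sum.cong refl) (simp add: power2_eq_square)
    thus ?thesis by simp
  qed
  hence "(\<Sum>a\<in>UNIV. \<Sum>b\<in>UNIV. contr ?X a b * contr ?X b a) = ?d * (k * (?d - 1))\<^sup>2"
    by simp
  thus ?thesis
    unfolding gb_scalar_def riem scal_const_curv by algebra
qed

section \<open>Partial derivatives and inverse matrices\<close>

lemma partial_eqI: "(f has_derivative f') (at x) \<Longrightarrow> partial i f x = f' (axis i 1)"
  unfolding partial_def by (metis frechet_derivative_at)

lemma partial_cong_open:
  assumes "open S" "x \<in> S" and eq: "\<And>y. y \<in> S \<Longrightarrow> f y = h y"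
  shows "partial i f x = partial i h x"
proof -
  \<comment> \<open>Both functions have the same set of derivatives at \<open>x\<close>, so the
    choice operator inside \<open>frechet_derivative\<close> returns the same map, even where no
    derivative exists.\<close>
  have "(f has_derivative D) (at x) \<longleftrightarrow> (h has_derivative D) (at x)" for D
    using assms has_derivative_transform_within_open[of f D x UNIV S h]
      has_derivative_transform_within_open[of h D x UNIV S f] by auto
  thus ?thesis unfolding partial_def frechet_derivative_def by simp
qed

lemma partial_const: "partial i (\<lambda>x. c) x = 0"
  by (simp add: partial_def)

lemma partial_add:
  assumes "f differentiable at x" "h differentiable at x"
  shows "partial i (\<lambda>y. f y + h y) x = partial i f x + partial i h x"
  using partial_eqI[OF has_derivative_add[OF assms[unfolded frechet_derivative_works]]]
  by (simp add: partial_def)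

lemma partial_mult:
  assumes "f differentiable at x" "h differentiable at x"
  shows "partial i (\<lambda>y. f y * h y) x = partial i f x * h x + f x * partial i h x"
  using partial_eqI[OF has_derivative_mult[OF assms[unfolded frechet_derivative_works]]]
  by (simp add: partial_def)

lemma partial_sum:
  assumes "finite A" "\<And>a. a \<in> A \<Longrightarrow> f a differentiable at x"
  shows "partial i (\<lambda>y. \<Sum>a\<in>A. f a y) x = (\<Sum>a\<in>A. partial i (f a) x)"
proof -
  have "((\<lambda>y. \<Sum>a\<in>A. f a y) has_derivative
      (\<lambda>v. \<Sum>a\<in>A. frechet_derivative (f a) (at x) v)) (at x)"
    by (intro has_derivative_sum) (use assms in \<open>auto simp: frechet_derivative_works\<close>)
  from partial_eqI[OF this] show ?thesis by (simp add: partial_def)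
qed

section \<open>Equality of mixed second partial derivatives\<close>

lemma has_field_derivative_line:
  assumes "f differentiable at (p + s *\<^sub>R axis i 1)"
  shows "((\<lambda>s. f (p + s *\<^sub>R axis i 1)) has_field_derivative partial i f (p + s *\<^sub>R axis i 1)) (at s)"
proof -
  have "((\<lambda>s. p + s *\<^sub>R axis i (1::real)) has_derivative (\<lambda>t. t *\<^sub>R axis i 1)) (at s)"
    by (auto intro!: derivative_eq_intros)
  from diff_chain_at[OF this assms[unfolded frechet_derivative_works]]
  have "((\<lambda>s. f (p + s *\<^sub>R axis i 1)) has_derivative
     (\<lambda>t. frechet_derivative f (at (p + s *\<^sub>R axis i 1)) (t *\<^sub>R axis i 1))) (at s)"
    by (simp add: o_def)
  moreover have "frechet_derivative f (at (p + s *\<^sub>R axis i 1)) (t *\<^sub>R axis i 1)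
      = partial i f (p + s *\<^sub>R axis i 1) * t" for t
    using linear_scale[OF linear_frechet_derivative[OF assms]] by (simp add: partial_def)
  ultimately show ?thesis by (simp add: has_field_derivative_def)
qed

text \<open>Two uses of the mean value theorem: first along \<open>axis i 1\<close>, for the
  increment of \<open>f\<close> in direction \<open>j\<close>, then along \<open>axis j 1\<close>,
  for \<open>partial i f\<close>. The left side is symmetric in \<open>i\<close> and
  \<open>j\<close>, which is what makes the two orders of differentiation comparable.\<close>

lemma second_difference_eq_partial:
  assumes S: "ball x e \<subseteq> S" and C2: "Ck_on 2 S f" and h: "0 < h" "2 * h < e"
  shows "\<exists>y. dist x y < e \<and> dist x y \<le> 2 * h \<and>
    f (x + h *\<^sub>R axis i 1 + h *\<^sub>R axis j 1) - f (x + h *\<^sub>R axis i 1)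
      - f (x + h *\<^sub>R axis j 1) + f x = h * h * partial j (partial i f) y"
proof -
  have near: "dist x (x + s *\<^sub>R axis i 1 + t *\<^sub>R axis j 1) \<le> 2 * h"
    if "0 \<le> s" "s \<le> h" "0 \<le> t" "t \<le> h" for s t
  proof -
    have "norm (s *\<^sub>R axis i (1::real) + t *\<^sub>R axis j 1) \<le> norm (s *\<^sub>R axis i (1::real)) + norm (t *\<^sub>R axis j (1::real))"
      by (rule norm_triangle_ineq)
    also have "\<dots> \<le> 2 * h" using that by simp
    finally show ?thesis by (metis add.assoc dist_add_cancel dist_0_norm add.right_neutral)
  qed
  have inS: "x + s *\<^sub>R axis i 1 + t *\<^sub>R axis j 1 \<in> S"
    if "0 \<le> s" "s \<le> h" "0 \<le> t" "t \<le> h" for s t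
    using near[OF that] S h by (auto simp: subset_iff)
  have d1: "f differentiable at y" and d2: "partial i f differentiable at y" if "y \<in> S" for y
    using C2 that by (auto simp: numeral_2_eq_2)
  have "\<exists>s>0. s < h \<and> (f (x + h *\<^sub>R axis i 1 + h *\<^sub>R axis j 1) - f (x + h *\<^sub>R axis i 1))
      - (f (x + 0 *\<^sub>R axis i 1 + h *\<^sub>R axis j 1) - f (x + 0 *\<^sub>R axis i 1)) =
      (h - 0) * (partial i f (x + s *\<^sub>R axis i 1 + h *\<^sub>R axis j 1) - partial i f (x + s *\<^sub>R axis i 1))"
  proof (rule MVT2[OF h(1)])
    fix s assume s: "0 \<le> s" "s \<le> h"
    have a: "((\<lambda>s. f ((x + h *\<^sub>R axis j 1) + s *\<^sub>R axis i 1)) has_field_derivative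
        partial i f ((x + h *\<^sub>R axis j 1) + s *\<^sub>R axis i 1)) (at s)"
      by (intro has_field_derivative_line d1) (use inS[of s h] s h in \<open>simp add: ac_simps\<close>)
    have b: "((\<lambda>s. f (x + s *\<^sub>R axis i 1)) has_field_derivative
        partial i f (x + s *\<^sub>R axis i 1)) (at s)"
      by (intro has_field_derivative_line d1) (use inS[of s 0] s h in simp)
    show "((\<lambda>s. f (x + s *\<^sub>R axis i 1 + h *\<^sub>R axis j 1) - f (x + s *\<^sub>R axis i 1)) has_field_derivative
       partial i f (x + s *\<^sub>R axis i 1 + h *\<^sub>R axis j 1) - partial i f (x + s *\<^sub>R axis i 1)) (at s)"
      using DERIV_diff[OF a b] by (simp add: ac_simps)
  qed
  then obtain s where s: "0 < s" "s < h" and eq1: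
    "f (x + h *\<^sub>R axis i 1 + h *\<^sub>R axis j 1) - f (x + h *\<^sub>R axis i 1)
      - f (x + h *\<^sub>R axis j 1) + f x =
      h * (partial i f (x + s *\<^sub>R axis i 1 + h *\<^sub>R axis j 1) - partial i f (x + s *\<^sub>R axis i 1))"
    by (auto simp: algebra_simps)
  have "\<exists>t>0. t < h \<and> partial i f (x + s *\<^sub>R axis i 1 + h *\<^sub>R axis j 1)
      - partial i f (x + s *\<^sub>R axis i 1 + 0 *\<^sub>R axis j 1) =
      (h - 0) * partial j (partial i f) (x + s *\<^sub>R axis i 1 + t *\<^sub>R axis j 1)"
    by (rule MVT2[OF h(1)], intro has_field_derivative_line d2 inS) (use s in auto)
  then obtain t where t: "0 < t" "t < h" and eq2:
    "partial i f (x + s *\<^sub>R axis i 1 + h *\<^sub>R axis j 1) - partial i f (x + s *\<^sub>R axis i 1) =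
      h * partial j (partial i f) (x + s *\<^sub>R axis i 1 + t *\<^sub>R axis j 1)"
    by auto
  show ?thesis
    using near[of s t] s t h eq1 eq2 by (intro exI[of _ "x + s *\<^sub>R axis i 1 + t *\<^sub>R axis j 1"]) auto
qed

lemma partial_commute:
  assumes "open S" "x \<in> S" and C2: "Ck_on 2 S f"
  shows "partial i (partial j f) x = partial j (partial i f) x"
proof (rule ccontr)
  assume ne: "partial i (partial j f) x \<noteq> partial j (partial i f) x"
  \<comment> \<open>With half the distance as tolerance, a value close to one mixed partial
    derivative at \<open>x\<close> cannot also be close to the other; the common second difference
    produces such a value.\<close>
  define \<epsilon> where "\<epsilon> = dist (partial i (partial j f) x) (partial j (partial i f) x) / 2"
  have eps: "\<epsilon> > 0" using ne by (simp add: \<epsilon>_def)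
  have "continuous_on S (partial a (partial b f))" for a b
    using C2 by (simp add: numeral_2_eq_2)
  hence "isCont (partial a (partial b f)) x" for a b
    using assms(1,2) continuous_on_eq_continuous_at by blast
  hence lim: "\<exists>d>0. \<forall>y. dist y x < d \<longrightarrow> dist (partial a (partial b f) y) (partial a (partial b f) x) < \<epsilon>" for a b
    using eps unfolding continuous_at_eps_delta by blast
  obtain d1 where d1: "d1 > 0" "\<And>y. dist x y < d1 \<Longrightarrow> dist (partial i (partial j f) y) (partial i (partial j f) x) < \<epsilon>"
    using lim[of i j] by (auto simp: dist_commute)
  obtain d2 where d2: "d2 > 0" "\<And>y. dist x y < d2 \<Longrightarrow> dist (partial j (partial i f) y) (partial j (partial i f) x) < \<epsilon>"
    using lim[of j i] by (auto simp: dist_commute)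
  obtain e0 where e0: "e0 > 0" "ball x e0 \<subseteq> S"
    using \<open>open S\<close> \<open>x \<in> S\<close> open_contains_ball by blast
  define e where "e = min e0 (min d1 d2)"
  define h where "h = e / 4"
  have e: "e > 0" "ball x e \<subseteq> S" using e0 d1 d2 by (auto simp: e_def)
  have h: "0 < h" "2 * h < e" using e by (auto simp: h_def)
  obtain y where y: "dist x y < e" and eqy:
    "f (x + h *\<^sub>R axis i 1 + h *\<^sub>R axis j 1) - f (x + h *\<^sub>R axis i 1)
      - f (x + h *\<^sub>R axis j 1) + f x = h * h * partial j (partial i f) y"
    using second_difference_eq_partial[OF e(2) C2 h, of i j] by blast
  obtain z where z: "dist x z < e" and eqz:
    "f (x + h *\<^sub>R axis j 1 + h *\<^sub>R axis i 1) - f (x + h *\<^sub>R axis j 1)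
      - f (x + h *\<^sub>R axis i 1) + f x = h * h * partial i (partial j f) z"
    using second_difference_eq_partial[OF e(2) C2 h, of j i] by blast
  have "x + h *\<^sub>R axis j 1 + h *\<^sub>R axis i 1 = x + h *\<^sub>R axis i 1 + h *\<^sub>R axis j 1"
    by (simp add: ac_simps)
  hence "h * h * partial j (partial i f) y = h * h * partial i (partial j f) z"
    using eqy eqz by (simp only:)
  hence "partial j (partial i f) y = partial i (partial j f) z" using h by simp
  moreover have "dist (partial j (partial i f) y) (partial j (partial i f) x) < \<epsilon>"
    "dist (partial i (partial j f) z) (partial i (partial j f) x) < \<epsilon>"
    using y z d1(2) d2(2) by (auto simp: e_def)
  ultimately show False
    using dist_triangle3[of "partial i (partial j f) x" "partial j (partial i f) x" "partial i (partial j f) z"]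
    by (simp add: \<epsilon>_def)
qed

section \<open>Differentiability of the inverse matrix\<close>

lemma differentiable_prod:
  fixes f :: "'i \<Rightarrow> 'a::real_normed_vector \<Rightarrow> real"
  assumes "finite A" "\<And>a. a \<in> A \<Longrightarrow> f a differentiable at x"
  shows "(\<lambda>y. \<Prod>a\<in>A. f a y) differentiable at x"
  using assms by (induction A rule: finite_induct) auto

lemma differentiable_det:
  fixes A :: "'a::real_normed_vector \<Rightarrow> real^'n^'n"
  assumes "\<And>a b. (\<lambda>y. A y $ a $ b) differentiable at x"
  shows "(\<lambda>y. det (A y)) differentiable at x"
  unfolding det_def
  by (intro differentiable_sum ballI differentiable_mult differentiable_prod assms differentiable_const)
     (auto intro: finite_permutations)

lemma matrix_inv_inverse:
  fixes A :: "real^'n^'n"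
  assumes "invertible A"
  shows matrix_mult_inv_right: "A ** matrix_inv A = mat 1"
    and matrix_mult_inv_left: "matrix_inv A ** A = mat 1"
  using someI_ex[OF assms[unfolded invertible_def]] by (auto simp: matrix_inv_def)

lemma matrix_inv_eqI:
  fixes A :: "real^'n^'n"
  assumes "A ** B = mat 1"
  shows "matrix_inv A = B"
proof -
  have "B ** A = mat 1" using assms matrix_left_right_inverse by blast
  hence "invertible A" using assms invertible_def by blast
  thus ?thesis
    by (metis assms matrix_mul_assoc matrix_mul_lid matrix_mul_rid matrix_mult_inv_left)
qed

text \<open>Cramer's rule applied to the equation that the columns of the inverse solve. It presents
  the entries as quotients of determinants, which are visibly differentiable in the entries of
  \<open>A\<close>.\<close>

lemma matrix_inv_cramer:
  fixes A :: "real^'n^'n"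
  assumes "invertible A"
  shows "matrix_inv A $ a $ b = det (\<chi> i j. if j = a then axis b 1 $ i else A $ i $ j) / det A"
proof -
  have d: "det A \<noteq> 0" using assms invertible_det_nz by blast
  have "A *v (matrix_inv A *v axis b 1) = axis b 1"
    using matrix_mult_inv_right[OF assms] by (simp add: matrix_vector_mul_assoc)
  hence "(matrix_inv A *v axis b 1) $ a = det (\<chi> i j. if j = a then axis b 1 $ i else A $ i $ j) / det A"
    unfolding cramer[OF d] by simp
  thus ?thesis by (simp add: matrix_vector_mult_basis column_def)
qed

lemma differentiable_matrix_inv:
  fixes A :: "'a::real_normed_vector \<Rightarrow> real^'n^'n"
  assumes "open S" "x \<in> S" and inv: "\<And>y. y \<in> S \<Longrightarrow> invertible (A y)"
    and diff: "\<And>a b. (\<lambda>y. A y $ a $ b) differentiable at x"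
  shows "(\<lambda>y. matrix_inv (A y) $ a $ b) differentiable at x"
proof -
  have "(\<lambda>y. det (\<chi> i j. if j = a then axis b 1 $ i else A y $ i $ j) / det (A y)) differentiable at x"
  proof (intro differentiable_divide differentiable_det diff)
    fix c d
    show "(\<lambda>y. (\<chi> i j. if j = a then axis b 1 $ i else A y $ i $ j) $ c $ d) differentiable at x"
      by (cases "d = a") (use diff in auto)
    show "det (A x) \<noteq> 0" using inv[OF assms(2)] invertible_det_nz by blast
  qed
  then obtain D where D: "((\<lambda>y. det (\<chi> i j. if j = a then axis b 1 $ i else A y $ i $ j) / det (A y))
     has_derivative D) (at x)" unfolding differentiable_def by blast
  have "((\<lambda>y. matrix_inv (A y) $ a $ b) has_derivative D) (at x)"
    using has_derivative_transform_within_open[OF D assms(1,2)] matrix_inv_cramer[OF inv] by simp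
  thus ?thesis unfolding differentiable_def by blast
qed

section \<open>Symmetries of the Riemann tensor\<close>

lemma inv_metric_right:
  assumes "invertible (g x)"
  shows "(\<Sum>b\<in>UNIV. g x $ a $ b * inv_metric g x b c) = (if a = c then 1 else 0)"
  using arg_cong[OF matrix_mult_inv_right[OF assms], of "\<lambda>A. A $ a $ c"]
  by (simp add: matrix_matrix_mult_def inv_metric_def mat_def)

lemma inv_metric_left:
  assumes "invertible (g x)"
  shows "(\<Sum>b\<in>UNIV. inv_metric g x a b * g x $ b $ c) = (if a = c then 1 else 0)"
  using arg_cong[OF matrix_mult_inv_left[OF assms], of "\<lambda>A. A $ a $ c"]
  by (simp add: matrix_matrix_mult_def inv_metric_def mat_def)

lemma inv_metric_sym:
  assumes "invertible (g x)" "transpose (g x) = g x"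
  shows "inv_metric g x a b = inv_metric g x b a"
proof -
  have "g x ** transpose (matrix_inv (g x)) = transpose (matrix_inv (g x) ** g x)"
    using assms(2) by (simp add: matrix_transpose_mul)
  also have "\<dots> = mat 1" using matrix_mult_inv_left[OF assms(1)] by (simp add: transpose_mat)
  finally have "matrix_inv (g x) = transpose (matrix_inv (g x))" by (rule matrix_inv_eqI)
  hence "matrix_inv (g x) $ a $ b = transpose (matrix_inv (g x)) $ a $ b" by (rule arg_cong)
  thus ?thesis by (simp add: inv_metric_def transpose_def)
qed

lemma riemann_uddd_antisym: "riemann_uddd g x a b d c = - riemann_uddd g x a b c d"
  unfolding riemann_uddd_def by (simp add: sum_subtractf)

lemma riemann_dddd_antisym_right: "riemann_dddd g x a b d c = - riemann_dddd g x a b c d"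
  unfolding riemann_dddd_def by (subst riemann_uddd_antisym) (simp add: sum_negf)

text \<open>Two continuous derivatives are what the curvature and the equality of mixed partials
  require. The metric is only asked to be symmetric and nondegenerate, so the Lorentzian and the
  Riemannian factor are both instances.\<close>

locale metric_chart =
  fixes g :: "real^'d::finite \<Rightarrow> real^'d^'d" and S :: "(real^'d) set"
  assumes open_S: "open S"
    and C2: "Ck_on 2 S (\<lambda>y. g y $ a $ b)"
    and sym: "y \<in> S \<Longrightarrow> transpose (g y) = g y"
    and inv: "y \<in> S \<Longrightarrow> invertible (g y)"
begin

text \<open>Christoffel symbols of the first kind. They contain no inverse metric, so the symmetries
  of the lowered Riemann tensor are easier to see in them.\<close>

definition lowered :: "real^'d \<Rightarrow> 'd \<Rightarrow> 'd \<Rightarrow> 'd \<Rightarrow> real" where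
  "lowered y e b c = (1/2) * (partial b (\<lambda>y. g y $ e $ c) y + partial c (\<lambda>y. g y $ e $ b) y
     - partial e (\<lambda>y. g y $ b $ c) y)"

lemma g_sym: "y \<in> S \<Longrightarrow> g y $ a $ b = g y $ b $ a"
  using arg_cong[OF sym[of y], of "\<lambda>A. A $ b $ a"] by (simp add: transpose_def)

lemma g_differentiable: "y \<in> S \<Longrightarrow> (\<lambda>y. g y $ a $ b) differentiable at y"
  using C2[of a b] by (simp add: numeral_2_eq_2)

lemma dg_differentiable: "y \<in> S \<Longrightarrow> partial c (\<lambda>y. g y $ a $ b) differentiable at y"
  using C2[of a b] by (simp add: numeral_2_eq_2)

lemma dg_sym: "y \<in> S \<Longrightarrow> partial c (\<lambda>y. g y $ a $ b) y = partial c (\<lambda>y. g y $ b $ a) y"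
  by (rule partial_cong_open[OF open_S]) (auto intro: g_sym)

lemma inv_metric_differentiable: "y \<in> S \<Longrightarrow> (\<lambda>y. inv_metric g y a b) differentiable at y"
  unfolding inv_metric_def
  by (rule differentiable_matrix_inv[OF open_S]) (auto intro: inv g_differentiable)

lemma lowered_differentiable: "y \<in> S \<Longrightarrow> (\<lambda>y. lowered y e b c) differentiable at y"
  unfolding lowered_def
  by (intro differentiable_mult differentiable_const differentiable_add differentiable_diff
      dg_differentiable)

lemma christoffel_eq: "christoffel g y a b c = (\<Sum>e\<in>UNIV. inv_metric g y a e * lowered y e b c)"
  unfolding christoffel_def lowered_def sum_distrib_left by (simp add: field_simps)

lemma christoffel_differentiable: "y \<in> S \<Longrightarrow> (\<lambda>y. christoffel g y a b c) differentiable at y"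
  unfolding christoffel_eq
  by (intro differentiable_sum ballI differentiable_mult inv_metric_differentiable
      lowered_differentiable) auto

lemma lowered_sym: "y \<in> S \<Longrightarrow> lowered y a b c = lowered y a c b"
  unfolding lowered_def using dg_sym[of y a b c] by simp

lemma christoffel_sym: "y \<in> S \<Longrightarrow> christoffel g y a b c = christoffel g y a c b"
  unfolding christoffel_eq using lowered_sym by simp

lemma lower_christoffel:
  assumes "y \<in> S"
  shows "(\<Sum>e\<in>UNIV. g y $ a $ e * christoffel g y e b c) = lowered y a b c"
proof -
  have "(\<Sum>e\<in>UNIV. g y $ a $ e * christoffel g y e b c)
      = (\<Sum>e\<in>UNIV. \<Sum>f\<in>UNIV. g y $ a $ e * inv_metric g y e f * lowered y f b c)"
    unfolding christoffel_eq by (simp add: sum_distrib_left mult.assoc)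
  also have "\<dots> = (\<Sum>f\<in>UNIV. (\<Sum>e\<in>UNIV. g y $ a $ e * inv_metric g y e f) * lowered y f b c)"
    by (subst sum.swap) (simp add: sum_distrib_right)
  also have "\<dots> = lowered y a b c"
    by (simp add: inv_metric_right[of g, OF inv[OF assms]] if_distrib[of "\<lambda>x. x * _"] cong: if_cong)
  finally show ?thesis .
qed

text \<open>This is the vanishing of the covariant derivative of the metric, written with symbols of
  the first kind.\<close>

lemma metric_compatible:
  assumes "y \<in> S"
  shows "partial c (\<lambda>y. g y $ a $ b) y = lowered y a c b + lowered y b c a"
  unfolding lowered_def using dg_sym[OF assms, of c a b] dg_sym[OF assms, of a b c] 
    dg_sym[OF assms, of b a c] by (simp add: field_simps)

text \<open>Pulling \<open>g\<close> inside the derivative of a Christoffel symbol costs a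
  derivative of \<open>g\<close>, which \<open>metric_compatible\<close> splits into two products.
  One of them cancels the quadratic term of the Riemann tensor; the other one is what
  remains.\<close>

lemma riemann_dddd_eq:
  assumes x: "x \<in> S"
  shows "riemann_dddd g x a b c d =
    partial c (\<lambda>y. lowered y a d b) x - partial d (\<lambda>y. lowered y a c b) x
    - (\<Sum>e\<in>UNIV. lowered x e c a * christoffel g x e d b)
    + (\<Sum>e\<in>UNIV. lowered x e d a * christoffel g x e c b)"
proof -
  have deriv: "(\<Sum>e\<in>UNIV. g x $ a $ e * partial c (\<lambda>y. christoffel g y e d b) x) =
      partial c (\<lambda>y. lowered y a d b) x
      - (\<Sum>e\<in>UNIV. (lowered x a c e + lowered x e c a) * christoffel g x e d b)" for c d
  proof -
    have "partial c (\<lambda>y. lowered y a d b) x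
        = partial c (\<lambda>y. \<Sum>e\<in>UNIV. g y $ a $ e * christoffel g y e d b) x"
      by (rule partial_cong_open[OF open_S x]) (simp add: lower_christoffel)
    also have "\<dots> = (\<Sum>e\<in>UNIV. partial c (\<lambda>y. g y $ a $ e) x * christoffel g x e d b
        + g x $ a $ e * partial c (\<lambda>y. christoffel g y e d b) x)"
      by (simp add: partial_sum partial_mult g_differentiable christoffel_differentiable x)
    also have "\<dots> = (\<Sum>e\<in>UNIV. (lowered x a c e + lowered x e c a) * christoffel g x e d b)
        + (\<Sum>e\<in>UNIV. g x $ a $ e * partial c (\<lambda>y. christoffel g y e d b) x)"
      by (simp add: sum.distrib metric_compatible x)
    finally show ?thesis by simp
  qed
  have quad: "(\<Sum>e\<in>UNIV. g x $ a $ e * (\<Sum>f\<in>UNIV. christoffel g x e c f * christoffel g x f d b)) =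
      (\<Sum>f\<in>UNIV. lowered x a c f * christoffel g x f d b)" for c d
  proof -
    have "(\<Sum>e\<in>UNIV. g x $ a $ e * (\<Sum>f\<in>UNIV. christoffel g x e c f * christoffel g x f d b)) =
      (\<Sum>f\<in>UNIV. \<Sum>e\<in>UNIV. g x $ a $ e * christoffel g x e c f * christoffel g x f d b)"
      by (subst sum.swap) (simp add: sum_distrib_left mult.assoc)
    also have "\<dots> = (\<Sum>f\<in>UNIV. lowered x a c f * christoffel g x f d b)"
      by (simp add: lower_christoffel[OF x, symmetric] sum_distrib_right)
    finally show ?thesis .
  qed
  have "riemann_dddd g x a b c d =
      (\<Sum>e\<in>UNIV. g x $ a $ e * partial c (\<lambda>y. christoffel g y e d b) x)
      - (\<Sum>e\<in>UNIV. g x $ a $ e * partial d (\<lambda>y. christoffel g y e c b) x)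
      + (\<Sum>e\<in>UNIV. g x $ a $ e * (\<Sum>f\<in>UNIV. christoffel g x e c f * christoffel g x f d b))
      - (\<Sum>e\<in>UNIV. g x $ a $ e * (\<Sum>f\<in>UNIV. christoffel g x e d f * christoffel g x f c b))"
    unfolding riemann_dddd_def riemann_uddd_def
    by (simp add: distrib_left right_diff_distrib sum.distrib sum_subtractf)
  thus ?thesis unfolding deriv quad by (simp add: distrib_right sum.distrib)
qed

text \<open>Each side is the product under \<open>g\<close> of the vectors of Christoffel symbols
  with lower indices \<open>a b\<close> and \<open>c d\<close>, and \<open>g\<close> is
  symmetric.\<close>

lemma lowered_christoffel_swap:
  assumes "x \<in> S"
  shows "(\<Sum>e\<in>UNIV. lowered x e a b * christoffel g x e c d) =
    (\<Sum>e\<in>UNIV. lowered x e c d * christoffel g x e a b)"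
proof -
  have "(\<Sum>e\<in>UNIV. lowered x e a b * christoffel g x e c d) =
     (\<Sum>e\<in>UNIV. \<Sum>f\<in>UNIV. g x $ e $ f * christoffel g x f a b * christoffel g x e c d)"
    by (simp add: lower_christoffel[OF assms, symmetric] sum_distrib_right)
  also have "\<dots> = (\<Sum>f\<in>UNIV. \<Sum>e\<in>UNIV. g x $ f $ e * christoffel g x e c d * christoffel g x f a b)"
    by (subst sum.swap) (simp add: g_sym[OF assms] mult_ac)
  also have "\<dots> = (\<Sum>e\<in>UNIV. lowered x e c d * christoffel g x e a b)"
    by (simp add: lower_christoffel[OF assms, symmetric] sum_distrib_right)
  finally show ?thesis .
qed

text \<open>Adding the formula for \<open>a b\<close> to that for \<open>b a\<close> turns the
  derivative terms into second partials of \<open>g y $ a $ b\<close>, which commute, while the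
  quadratic terms cancel by \<open>lowered_christoffel_swap\<close>.\<close>

lemma riemann_dddd_antisym_left:
  assumes x: "x \<in> S"
  shows "riemann_dddd g x b a c d = - riemann_dddd g x a b c d"
proof -
  have d: "partial c (\<lambda>y. lowered y a d b) x + partial c (\<lambda>y. lowered y b d a) x
      = partial c (partial d (\<lambda>y. g y $ a $ b)) x" for c d
  proof -
    have "partial c (partial d (\<lambda>y. g y $ a $ b)) x
        = partial c (\<lambda>y. lowered y a d b + lowered y b d a) x"
      by (rule partial_cong_open[OF open_S x]) (simp add: metric_compatible)
    thus ?thesis by (simp add: partial_add lowered_differentiable x)
  qed
  have "riemann_dddd g x a b c d + riemann_dddd g x b a c d = 0"
    unfolding riemann_dddd_eq[OF x]
    using d[of c d] d[of d c] partial_commute[OF open_S x C2, of c d a b]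
      lowered_christoffel_swap[OF x, of c a d b] lowered_christoffel_swap[OF x, of d a c b]
    by linarith
  thus ?thesis by linarith
qed

text \<open>The connection is torsion free: symmetry of the Christoffel symbols in their lower
  indices, which holds on the whole chart and so also under a derivative, cancels the cyclic sum
  term by term.\<close>

lemma riemann_uddd_bianchi:
  assumes x: "x \<in> S"
  shows "riemann_uddd g x a b c d + riemann_uddd g x a c d b + riemann_uddd g x a d b c = 0"
proof -
  have dsym: "partial c (\<lambda>y. christoffel g y a d b) x = partial c (\<lambda>y. christoffel g y a b d) x" for b c d
    by (rule partial_cong_open[OF open_S x]) (rule christoffel_sym)
  show ?thesis
    unfolding riemann_uddd_def sum_subtractf
    using dsym[of b d c] dsym[of c d b] dsym[of d c b]
    by (simp add: christoffel_sym[OF x, of _ c b] christoffel_sym[OF x, of _ d b]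
        christoffel_sym[OF x, of _ d c])
qed

lemma riemann_dddd_bianchi:
  assumes x: "x \<in> S"
  shows "riemann_dddd g x a b c d + riemann_dddd g x a c d b + riemann_dddd g x a d b c = 0"
proof -
  have "riemann_dddd g x a b c d + riemann_dddd g x a c d b + riemann_dddd g x a d b c =
    (\<Sum>e\<in>UNIV. g x $ a $ e * (riemann_uddd g x e b c d + riemann_uddd g x e c d b + riemann_uddd g x e d b c))"
    unfolding riemann_dddd_def by (simp add: sum.distrib distrib_left)
  thus ?thesis using riemann_uddd_bianchi[OF x] by simp
qed

text \<open>The classical linear combination of four cyclic identities, one for each index in the
  first slot, with the signs supplied by the two antisymmetries.\<close>

lemma riemann_dddd_pair_sym:
  assumes x: "x \<in> S"
  shows "riemann_dddd g x a b c d = riemann_dddd g x c d a b"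
proof -
  note bi = riemann_dddd_bianchi[OF x]
  note l = riemann_dddd_antisym_left[OF x]
  note r = riemann_dddd_antisym_right[of g x]
  show ?thesis
    using bi[of a b c d] bi[of b c d a] bi[of c d a b] bi[of d a b c]
      l[of a b c d] l[of a c b d] r[of a c d b] l[of a d b c] l[of b c d a]
      l[of b d c a] r[of b d a c] l[of c d a b]
    by linarith
qed

end

section \<open>Field equations in terms of the mixed Riemann tensor\<close>

definition riemann_mixed :: "(real^'d::finite \<Rightarrow> real^'d^'d) \<Rightarrow> real^'d \<Rightarrow> 'd \<Rightarrow> 'd \<Rightarrow> 'd \<Rightarrow> 'd \<Rightarrow> real" where
  "riemann_mixed g x a b c d = (\<Sum>q\<in>UNIV. inv_metric g x b q * riemann_uddd g x a q c d)"

lemma riemann_mixed_antisym_right: "riemann_mixed g x a b d c = - riemann_mixed g x a b c d"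
  unfolding riemann_mixed_def by (subst riemann_uddd_antisym) (simp add: sum_negf)

lemma contr_riemann_mixed: "contr (riemann_mixed g x) a b = (\<Sum>c\<in>UNIV. inv_metric g x a c * ricci_dd g x c b)"
  unfolding contr_def riemann_mixed_def ricci_dd_def sum_distrib_left by (rule sum.swap)

lemma contr_riemann_mixed_ud: "contr (riemann_mixed g x) a b = ricci_ud g x a b"
  unfolding contr_riemann_mixed ricci_ud_def ..

lemma scal_riemann_mixed: "scal (riemann_mixed g x) = scalar_curv g x"
  unfolding scal_def scalar_curv_def contr_riemann_mixed_ud ..

text \<open>The algebraic facts at a single point on which index manipulation rests. Stated apart
  from any differentiability, they pass to the product metric from its two factors.\<close>

locale curvature_point =
  fixes g :: "real^'d::finite \<Rightarrow> real^'d^'d" and x :: "real^'d"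
  assumes inv: "invertible (g x)" and sym: "transpose (g x) = g x"
    and antisym: "riemann_dddd g x b a c d = - riemann_dddd g x a b c d"
    and pair_sym: "riemann_dddd g x a b c d = riemann_dddd g x c d a b"
begin

abbreviation "G \<equiv> inv_metric g x"
abbreviation "Rm \<equiv> riemann_dddd g x"
abbreviation "X \<equiv> riemann_mixed g x"

lemma riemann_raise: "(\<Sum>p\<in>UNIV. G a p * Rm p b c d) = riemann_uddd g x a b c d"
proof -
  have "(\<Sum>p\<in>UNIV. G a p * Rm p b c d)
      = (\<Sum>e\<in>UNIV. (\<Sum>p\<in>UNIV. G a p * g x $ p $ e) * riemann_uddd g x e b c d)"
    unfolding riemann_dddd_def sum_distrib_left sum_distrib_right mult.assoc by (rule sum.swap)
  also have "\<dots> = riemann_uddd g x a b c d"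
    by (simp add: inv_metric_left[of g, OF inv] if_distrib[of "\<lambda>x. x * _"] cong: if_cong)
  finally show ?thesis .
qed

lemma riemann_mixed_eq: "X a b c d = (\<Sum>q\<in>UNIV. \<Sum>p\<in>UNIV. G a p * G b q * Rm p q c d)"
  unfolding riemann_mixed_def riemann_raise[symmetric] sum_distrib_left by (simp add: mult_ac)

lemma riemann_mixed_antisym_left: "X b a c d = - X a b c d"
proof -
  have "X b a c d = (\<Sum>q\<in>UNIV. \<Sum>p\<in>UNIV. G a q * G b p * Rm p q c d)"
    unfolding riemann_mixed_eq by (simp add: mult_ac)
  also have "\<dots> = (\<Sum>p\<in>UNIV. \<Sum>q\<in>UNIV. G a q * G b p * (- Rm q p c d))"
    by (subst sum.swap, subst antisym) simp
  also have "\<dots> = - X a b c d"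
    unfolding riemann_mixed_eq by (simp add: sum_negf)
  finally show ?thesis .
qed

lemma G_sym: "G a b = G b a"
  by (rule inv_metric_sym[of g, OF inv sym])

lemma riemann_mixed_eq': "X a b c d = (\<Sum>q\<in>UNIV. \<Sum>p\<in>UNIV. G a p * G b q * Rm c d p q)"
  unfolding riemann_mixed_eq by (subst pair_sym) (rule refl)

text \<open>The Ricci tensor is the trace of the lowered Riemann tensor under the symmetric
  \<open>G\<close>, so pair symmetry exchanges its two indices.\<close>

lemma ricci_sym: "ricci_dd g x a b = ricci_dd g x b a"
proof -
  have e: "ricci_dd g x a b = (\<Sum>c\<in>UNIV. \<Sum>p\<in>UNIV. G c p * Rm p a c b)" for a b
    unfolding ricci_dd_def riemann_raise ..
  have "ricci_dd g x a b = (\<Sum>c\<in>UNIV. \<Sum>p\<in>UNIV. G p c * Rm c b p a)"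
    unfolding e by (subst pair_sym, subst G_sym) (rule refl)
  also have "\<dots> = ricci_dd g x b a" unfolding e by (rule sum.swap)
  finally show ?thesis .
qed

lemma ricci_uu_eq: "ricci_uu g x a b = (\<Sum>e\<in>UNIV. G a e * ricci_ud g x b e)"
proof -
  have "ricci_uu g x a b = (\<Sum>c\<in>UNIV. \<Sum>e\<in>UNIV. G b c * (G a e * ricci_dd g x e c))"
    unfolding ricci_uu_def ricci_ud_def sum_distrib_left ..
  also have "\<dots> = (\<Sum>e\<in>UNIV. \<Sum>c\<in>UNIV. G a e * (G b c * ricci_dd g x c e))"
    by (subst sum.swap, subst ricci_sym) (simp add: mult_ac)
  finally show ?thesis unfolding ricci_ud_def sum_distrib_left .
qed

section \<open>Quadratic curvature contractions rewritten with mixed tensors\<close>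

lemma ricci_square: "(\<Sum>a\<in>UNIV. \<Sum>b\<in>UNIV. ricci_dd g x a b * ricci_uu g x a b)
    = (\<Sum>a\<in>UNIV. \<Sum>b\<in>UNIV. ricci_ud g x a b * ricci_ud g x b a)"
proof -
  have "(\<Sum>a\<in>UNIV. \<Sum>b\<in>UNIV. ricci_dd g x a b * ricci_uu g x a b)
      = (\<Sum>a\<in>UNIV. \<Sum>b\<in>UNIV. \<Sum>e\<in>UNIV. G e a * ricci_dd g x a b * ricci_ud g x b e)"
    unfolding ricci_uu_eq sum_distrib_left by (subst G_sym) (simp add: mult_ac)
  also have "\<dots> = (\<Sum>a\<in>UNIV. \<Sum>e\<in>UNIV. \<Sum>b\<in>UNIV. G e a * ricci_dd g x a b * ricci_ud g x b e)"
    by (intro sum.cong refl sum.swap)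
  also have "\<dots> = (\<Sum>e\<in>UNIV. \<Sum>a\<in>UNIV. \<Sum>b\<in>UNIV. G e a * ricci_dd g x a b * ricci_ud g x b e)"
    by (rule sum.swap)
  also have "\<dots> = (\<Sum>e\<in>UNIV. \<Sum>b\<in>UNIV. \<Sum>a\<in>UNIV. G e a * ricci_dd g x a b * ricci_ud g x b e)"
    by (intro sum.cong refl sum.swap)
  also have "\<dots> = (\<Sum>e\<in>UNIV. \<Sum>b\<in>UNIV. ricci_ud g x e b * ricci_ud g x b e)"
    by (simp add: ricci_ud_def sum_distrib_right)
  finally show ?thesis .
qed

text \<open>The two inverse metrics move from \<open>F\<close> to the last pair of
  \<open>Rm n a b c\<close>; by pair symmetry the raised pair may then stand in front. This serves
  both the Riemann square in \<open>L_GB\<close> and the Riemann square with free indices in the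
  Gauss-Bonnet tensor.\<close>

lemma riemann_pair_contract:
  "(\<Sum>b\<in>UNIV. \<Sum>c\<in>UNIV. (\<Sum>q\<in>UNIV. \<Sum>r\<in>UNIV. G b q * G c r * F q r) * Rm n a b c)
    = (\<Sum>q\<in>UNIV. \<Sum>r\<in>UNIV. F q r * X q r n a)"
proof -
  have "(\<Sum>b\<in>UNIV. \<Sum>c\<in>UNIV. (\<Sum>q\<in>UNIV. \<Sum>r\<in>UNIV. G b q * G c r * F q r) * Rm n a b c)
    = (\<Sum>b\<in>UNIV. \<Sum>c\<in>UNIV. \<Sum>q\<in>UNIV. \<Sum>r\<in>UNIV. F q r * (G q b * G r c * Rm n a b c))"
    unfolding sum_distrib_right by (subst (1 2) G_sym) (simp add: mult_ac)
  also have "\<dots> = (\<Sum>q\<in>UNIV. \<Sum>r\<in>UNIV. \<Sum>c\<in>UNIV. \<Sum>b\<in>UNIV. F q r * (G q b * G r c * Rm n a b c))"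
    unfolding sum.cartesian_product
    by (rule sum.reindex_bij_witness[where i="\<lambda>(q,r,c,b). (b,c,q,r)" and j="\<lambda>(b,c,q,r). (q,r,c,b)"]) auto
  also have "\<dots> = (\<Sum>q\<in>UNIV. \<Sum>r\<in>UNIV. F q r * X q r n a)"
    unfolding riemann_mixed_eq' sum_distrib_left ..
  finally show ?thesis .
qed

lemma riemann_duuu_eq: "riemann_duuu g x e b c d =
   (\<Sum>q\<in>UNIV. \<Sum>r\<in>UNIV. G c q * G d r * (\<Sum>p\<in>UNIV. G b p * Rm e p q r))"
proof -
  have "riemann_duuu g x e b c d = (\<Sum>q\<in>UNIV. \<Sum>p\<in>UNIV. \<Sum>r\<in>UNIV. G b p * G c q * G d r * Rm e p q r)"
    unfolding riemann_duuu_def by (rule sum.swap)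
  also have "\<dots> = (\<Sum>q\<in>UNIV. \<Sum>r\<in>UNIV. \<Sum>p\<in>UNIV. G b p * G c q * G d r * Rm e p q r)"
    by (intro sum.cong refl sum.swap)
  finally show ?thesis by (simp add: sum_distrib_left mult_ac)
qed

lemma riemann_uuuu_eq: "riemann_uuuu g x a b c d = (\<Sum>q\<in>UNIV. \<Sum>r\<in>UNIV. G c q * G d r * X a b q r)"
proof -
  have "riemann_uuuu g x a b c d =
      (\<Sum>e\<in>UNIV. \<Sum>q\<in>UNIV. \<Sum>r\<in>UNIV. \<Sum>p\<in>UNIV. G a e * (G c q * G d r * (G b p * Rm e p q r)))"
    unfolding riemann_uuuu_def riemann_duuu_eq sum_distrib_left ..
  also have "\<dots> = (\<Sum>q\<in>UNIV. \<Sum>e\<in>UNIV. \<Sum>r\<in>UNIV. \<Sum>p\<in>UNIV. G a e * (G c q * G d r * (G b p * Rm e p q r)))"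
    by (rule sum.swap)
  also have "\<dots> = (\<Sum>q\<in>UNIV. \<Sum>r\<in>UNIV. \<Sum>e\<in>UNIV. \<Sum>p\<in>UNIV. G a e * (G c q * G d r * (G b p * Rm e p q r)))"
    by (intro sum.cong refl sum.swap)
  also have "\<dots> = (\<Sum>q\<in>UNIV. \<Sum>r\<in>UNIV. \<Sum>p\<in>UNIV. \<Sum>e\<in>UNIV. G a e * (G c q * G d r * (G b p * Rm e p q r)))"
    by (intro sum.cong refl sum.swap)
  also have "\<dots> = (\<Sum>q\<in>UNIV. \<Sum>r\<in>UNIV. G c q * G d r * X a b q r)"
    unfolding riemann_mixed_eq sum_distrib_left by (simp add: mult_ac)
  finally show ?thesis .
qed

lemma riemann_square: "(\<Sum>a\<in>UNIV. \<Sum>b\<in>UNIV. \<Sum>c\<in>UNIV. \<Sum>d\<in>UNIV. Rm a b c d * riemann_uuuu g x a b c d)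
    = (\<Sum>a\<in>UNIV. \<Sum>b\<in>UNIV. \<Sum>c\<in>UNIV. \<Sum>d\<in>UNIV. X a b c d * X c d a b)"
proof -
  have "(\<Sum>c\<in>UNIV. \<Sum>d\<in>UNIV. Rm a b c d * riemann_uuuu g x a b c d)
      = (\<Sum>c\<in>UNIV. \<Sum>d\<in>UNIV. X a b c d * X c d a b)" for a b
    using riemann_pair_contract[of "X a b" a b] unfolding riemann_uuuu_eq
    by (simp add: mult.commute)
  thus ?thesis by simp
qed

lemma L_GB_eq: "L_GB g x = gb_scalar X"
  unfolding L_GB_def gb_scalar_def scal_riemann_mixed contr_riemann_mixed_ud ricci_square
    riemann_square ..

lemma raise_ricci: "(\<Sum>r\<in>UNIV. G m r * ricci_dd g x r n) = contr X m n"
  unfolding contr_riemann_mixed ..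

lemma raise_metric: "(\<Sum>r\<in>UNIV. G m r * g x $ r $ n) = (if m = n then 1 else 0)"
  by (rule inv_metric_left[of g, OF inv])

lemma raise_einstein: "(\<Sum>r\<in>UNIV. G m r * einstein_dd g x r n)
    = contr X m n - (1/2) * (if m = n then 1 else 0) * scal X"
proof -
  have "(\<Sum>r\<in>UNIV. G m r * einstein_dd g x r n) = (\<Sum>r\<in>UNIV. G m r * ricci_dd g x r n)
      - (1/2) * (\<Sum>r\<in>UNIV. G m r * g x $ r $ n) * scal X"
    unfolding einstein_dd_def scal_riemann_mixed
    by (simp add: right_diff_distrib sum_subtractf sum_distrib_left sum_distrib_right sum_divide_distrib mult_ac)
  thus ?thesis unfolding raise_ricci raise_metric .
qed

lemma raise_ricci_ricci: "(\<Sum>r\<in>UNIV. G m r * (\<Sum>a\<in>UNIV. ricci_dd g x r a * ricci_ud g x a n))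
    = (\<Sum>a\<in>UNIV. contr X m a * contr X a n)"
proof -
  have "(\<Sum>r\<in>UNIV. G m r * (\<Sum>a\<in>UNIV. ricci_dd g x r a * ricci_ud g x a n))
      = (\<Sum>a\<in>UNIV. \<Sum>r\<in>UNIV. G m r * ricci_dd g x r a * ricci_ud g x a n)"
    by (subst sum.swap) (simp add: sum_distrib_left mult_ac)
  thus ?thesis by (simp add: contr_riemann_mixed_ud ricci_ud_def[of g x m] sum_distrib_right)
qed

lemma raise_ricci_riemann:
  "(\<Sum>r\<in>UNIV. G m r * (\<Sum>a\<in>UNIV. \<Sum>b\<in>UNIV. ricci_uu g x a b * Rm r a n b))
    = (\<Sum>a\<in>UNIV. \<Sum>b\<in>UNIV. X m a n b * contr X b a)"
proof -
  have "(\<Sum>r\<in>UNIV. G m r * (\<Sum>a\<in>UNIV. \<Sum>b\<in>UNIV. ricci_uu g x a b * Rm r a n b))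
      = (\<Sum>r\<in>UNIV. \<Sum>a\<in>UNIV. \<Sum>b\<in>UNIV. \<Sum>e\<in>UNIV. G m r * (G e a * ricci_ud g x b e * Rm r a n b))"
    unfolding ricci_uu_eq sum_distrib_left sum_distrib_right by (simp add: G_sym)
  also have "\<dots> = (\<Sum>e\<in>UNIV. \<Sum>b\<in>UNIV. \<Sum>a\<in>UNIV. \<Sum>r\<in>UNIV. G m r * (G e a * ricci_ud g x b e * Rm r a n b))"
    unfolding sum.cartesian_product
    by (rule sum.reindex_bij_witness[where i="\<lambda>(e,b,a,r). (r,a,b,e)" and j="\<lambda>(r,a,b,e). (e,b,a,r)"]) auto
  also have "\<dots> = (\<Sum>a\<in>UNIV. \<Sum>b\<in>UNIV. X m a n b * contr X b a)"
    unfolding riemann_mixed_eq contr_riemann_mixed_ud sum_distrib_left sum_distrib_right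
    by (simp add: mult_ac)
  finally show ?thesis .
qed

lemma raise_riemann_riemann:
  "(\<Sum>r\<in>UNIV. G m r * (\<Sum>a\<in>UNIV. \<Sum>b\<in>UNIV. \<Sum>c\<in>UNIV. riemann_duuu g x r a b c * Rm n a b c))
    = (\<Sum>a\<in>UNIV. \<Sum>b\<in>UNIV. \<Sum>c\<in>UNIV. X m a b c * X b c n a)"
proof -
  have "(\<Sum>r\<in>UNIV. G m r * (\<Sum>a\<in>UNIV. \<Sum>b\<in>UNIV. \<Sum>c\<in>UNIV. riemann_duuu g x r a b c * Rm n a b c))
     = (\<Sum>a\<in>UNIV. \<Sum>r\<in>UNIV. \<Sum>b\<in>UNIV. \<Sum>c\<in>UNIV. G m r * (riemann_duuu g x r a b c * Rm n a b c))"
    unfolding sum_distrib_left by (rule sum.swap)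
  also have "\<dots> = (\<Sum>a\<in>UNIV. \<Sum>b\<in>UNIV. \<Sum>r\<in>UNIV. \<Sum>c\<in>UNIV. G m r * (riemann_duuu g x r a b c * Rm n a b c))"
    by (intro sum.cong refl sum.swap)
  also have "\<dots> = (\<Sum>a\<in>UNIV. \<Sum>b\<in>UNIV. \<Sum>c\<in>UNIV. \<Sum>r\<in>UNIV. G m r * (riemann_duuu g x r a b c * Rm n a b c))"
    by (intro sum.cong refl sum.swap)
  also have "\<dots> = (\<Sum>a\<in>UNIV. \<Sum>b\<in>UNIV. \<Sum>c\<in>UNIV. riemann_uuuu g x m a b c * Rm n a b c)"
    unfolding riemann_uuuu_def sum_distrib_right mult.assoc ..
  also have "\<dots> = (\<Sum>a\<in>UNIV. \<Sum>b\<in>UNIV. \<Sum>c\<in>UNIV. X m a b c * X b c n a)"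
    unfolding riemann_uuuu_eq riemann_pair_contract ..
  finally show ?thesis .
qed

lemma raise_gauss_bonnet: "(\<Sum>r\<in>UNIV. G m r * gauss_bonnet_dd g x r n) = gb_tensor X m n"
proof -
  have "(\<Sum>r\<in>UNIV. G m r * gauss_bonnet_dd g x r n) =
    2 * (scalar_curv g x * (\<Sum>r\<in>UNIV. G m r * ricci_dd g x r n)
      - 2 * (\<Sum>r\<in>UNIV. G m r * (\<Sum>a\<in>UNIV. ricci_dd g x r a * ricci_ud g x a n))
      - 2 * (\<Sum>r\<in>UNIV. G m r * (\<Sum>a\<in>UNIV. \<Sum>b\<in>UNIV. ricci_uu g x a b * Rm r a n b))
      + (\<Sum>r\<in>UNIV. G m r * (\<Sum>a\<in>UNIV. \<Sum>b\<in>UNIV. \<Sum>c\<in>UNIV. riemann_duuu g x r a b c * Rm n a b c)))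
    - (1/2) * (\<Sum>r\<in>UNIV. G m r * g x $ r $ n) * L_GB g x"
  proof -
    \<comment> \<open>Linearity is shown for arbitrary families, so that the simplifier does not
      meet the sums inside the tensors.\<close>
    have "(\<Sum>r\<in>UNIV. G r * (2 * (s * A r - 2 * B r - 2 * C r + D r) - 1 / 2 * E r * L)) =
      2 * (s * (\<Sum>r\<in>UNIV. G r * A r) - 2 * (\<Sum>r\<in>UNIV. G r * B r) - 2 * (\<Sum>r\<in>UNIV. G r * C r)
       + (\<Sum>r\<in>UNIV. G r * D r)) - (1/2) * (\<Sum>r\<in>UNIV. G r * E r) * L"
      for G A B C D E :: "'d \<Rightarrow> real" and s L
      unfolding sum_distrib_left sum_distrib_right sum.distrib[symmetric] sum_subtractf[symmetric]
      by (rule sum.cong) (auto simp: algebra_simps)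
    thus ?thesis unfolding gauss_bonnet_dd_def .
  qed
  thus ?thesis
    unfolding raise_ricci raise_ricci_ricci raise_ricci_riemann raise_riemann_riemann raise_metric
      L_GB_eq gb_tensor_def scal_riemann_mixed .
qed

text \<open>From here on the metric enters the field equations only through its mixed Riemann
  tensor, so they can be evaluated on a direct sum.\<close>

lemma egb_ud_eq: "egb_ud \<alpha> \<Lambda> g x m n = contr X m n - (1/2) * (if m = n then 1 else 0) * scal X
    + \<alpha> * gb_tensor X m n + \<Lambda> * (if m = n then 1 else 0)"
  unfolding egb_ud_def raise_einstein raise_gauss_bonnet ..

end

section \<open>Product metrics\<close>

definition fst_coords :: "real^('c::finite + 'd::finite) \<Rightarrow> real^'c" where
  "fst_coords x = (\<chi> i. x $ Inl i)"

definition snd_coords :: "real^('c::finite + 'd::finite) \<Rightarrow> real^'d" where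
  "snd_coords x = (\<chi> i. x $ Inr i)"

lemma fst_coords_axis [simp]:
  "fst_coords (axis (Inl i) 1) = axis i 1" "fst_coords (axis (Inr j) 1) = 0"
  by (simp_all add: fst_coords_def axis_def vec_eq_iff)

lemma snd_coords_axis [simp]:
  "snd_coords (axis (Inr i) 1) = axis i 1" "snd_coords (axis (Inl j) 1) = 0"
  by (simp_all add: snd_coords_def axis_def vec_eq_iff)

lemma bounded_linear_fst_coords: "bounded_linear (fst_coords :: real^('c::finite + 'd::finite) \<Rightarrow> _)"
  by (intro linear_conv_bounded_linear[THEN iffD1] linearI) (simp_all add: fst_coords_def vec_eq_iff)

lemma bounded_linear_snd_coords: "bounded_linear (snd_coords :: real^('c::finite + 'd::finite) \<Rightarrow> _)"
  by (intro linear_conv_bounded_linear[THEN iffD1] linearI) (simp_all add: snd_coords_def vec_eq_iff)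

lemma partial_fst_coords:
  fixes x :: "real^('c::finite + 'd::finite)"
  assumes "f differentiable at (fst_coords x)"
  shows "partial (Inl i) (\<lambda>y. f (fst_coords y)) x = partial i f (fst_coords x)"
    and "partial (Inr j) (\<lambda>y. f (fst_coords y)) x = 0"
proof -
  have "(fst_coords has_derivative fst_coords) (at x)"
    by (rule bounded_linear_imp_has_derivative[OF bounded_linear_fst_coords])
  from diff_chain_at[OF this assms[unfolded frechet_derivative_works]]
  have D: "((\<lambda>y. f (fst_coords y)) has_derivative
      (\<lambda>v. frechet_derivative f (at (fst_coords x)) (fst_coords v))) (at x)"
    by (simp add: o_def)
  show "partial (Inl i) (\<lambda>y. f (fst_coords y)) x = partial i f (fst_coords x)"
    using partial_eqI[OF D] by (simp add: partial_def)
  show "partial (Inr j) (\<lambda>y. f (fst_coords y)) x = 0"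
    using partial_eqI[OF D] linear_0[OF linear_frechet_derivative[OF assms]] by simp
qed

lemma partial_snd_coords:
  fixes x :: "real^('c::finite + 'd::finite)"
  assumes "f differentiable at (snd_coords x)"
  shows "partial (Inr i) (\<lambda>y. f (snd_coords y)) x = partial i f (snd_coords x)"
    and "partial (Inl j) (\<lambda>y. f (snd_coords y)) x = 0"
proof -
  have "(snd_coords has_derivative snd_coords) (at x)"
    by (rule bounded_linear_imp_has_derivative[OF bounded_linear_snd_coords])
  from diff_chain_at[OF this assms[unfolded frechet_derivative_works]]
  have D: "((\<lambda>y. f (snd_coords y)) has_derivative
      (\<lambda>v. frechet_derivative f (at (snd_coords x)) (snd_coords v))) (at x)"
    by (simp add: o_def)
  show "partial (Inr i) (\<lambda>y. f (snd_coords y)) x = partial i f (snd_coords x)"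
    using partial_eqI[OF D] by (simp add: partial_def)
  show "partial (Inl j) (\<lambda>y. f (snd_coords y)) x = 0"
    using partial_eqI[OF D] linear_0[OF linear_frechet_derivative[OF assms]] by simp
qed

section \<open>Block-diagonal matrices and their inverses\<close>

definition block_diag :: "real^'c^'c \<Rightarrow> real^'d^'d \<Rightarrow> real^('c::finite + 'd::finite)^('c + 'd)" where
  "block_diag A B = (\<chi> a b. case a of
      Inl i \<Rightarrow> (case b of Inl j \<Rightarrow> A $ i $ j | Inr j \<Rightarrow> 0)
    | Inr i \<Rightarrow> (case b of Inl j \<Rightarrow> 0 | Inr j \<Rightarrow> B $ i $ j))"

lemma block_diag_nth [simp]:
  "block_diag A B $ Inl i $ Inl j = A $ i $ j"
  "block_diag A B $ Inl i $ Inr b = 0"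
  "block_diag A B $ Inr a $ Inl j = 0"
  "block_diag A B $ Inr a $ Inr b = B $ a $ b"
  by (simp_all add: block_diag_def)

lemma block_diag_mult: "block_diag A B ** block_diag A' B' = block_diag (A ** A') (B ** B')"
  unfolding vec_eq_iff
  by (intro allI, case_tac i; case_tac ia) (simp_all add: matrix_matrix_mult_def sum_UNIV_Plus)

lemma block_diag_mat: "block_diag (mat 1) (mat 1) = mat 1"
  unfolding vec_eq_iff by (intro allI, case_tac i; case_tac ia) (simp_all add: mat_def)

lemma transpose_block_diag: "transpose (block_diag A B) = block_diag (transpose A) (transpose B)"
  unfolding vec_eq_iff by (intro allI, case_tac i; case_tac ia) (simp_all add: transpose_def)

lemma matrix_inv_block_diag:
  assumes "invertible A" "invertible B"
  shows "matrix_inv (block_diag A B) = block_diag (matrix_inv A) (matrix_inv B)"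
  by (rule matrix_inv_eqI)
     (simp add: block_diag_mult block_diag_mat matrix_mult_inv_right assms)

lemma invertible_block_diag:
  assumes "invertible A" "invertible B"
  shows "invertible (block_diag A B)"
  using assms unfolding invertible_def by (metis block_diag_mult block_diag_mat)

lemma matrix_mult_scaleR_inv:
  fixes A :: "real^'n^'n"
  assumes "invertible A" "c \<noteq> 0"
  shows "(c *\<^sub>R A) ** ((1 / c) *\<^sub>R matrix_inv A) = mat 1"
  using assms
  by (simp add: matrix_scalar_ac matrix_mult_inv_right scaleR_one flip: scalar_matrix_assoc)

section \<open>Connection and curvature of the product metric in a chart\<close>

locale product_chart = M: metric_chart g S + K: metric_chart h T
  for g :: "real^'c::finite \<Rightarrow> real^'c^'c" and S and h :: "real^'d::finite \<Rightarrow> real^'d^'d" and T +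
  fixes r :: real
  assumes r_pos: "r > 0"
begin

definition P :: "real^('c + 'd) \<Rightarrow> real^('c + 'd)^('c + 'd)" where
  "P x = block_diag (g (fst_coords x)) (r\<^sup>2 *\<^sub>R h (snd_coords x))"

definition U :: "(real^('c + 'd)) set" where
  "U = fst_coords -` S \<inter> snd_coords -` T"

lemma U_fst: "x \<in> U \<Longrightarrow> fst_coords x \<in> S" and U_snd: "x \<in> U \<Longrightarrow> snd_coords x \<in> T"
  by (auto simp: U_def)

lemma open_U: "open U"
  unfolding U_def
  by (intro open_Int open_vimage M.open_S K.open_S linear_continuous_on
      bounded_linear_fst_coords bounded_linear_snd_coords)

lemma invertible_K: "x \<in> U \<Longrightarrow> invertible (r\<^sup>2 *\<^sub>R h (snd_coords x))"
  using r_pos by (intro scalar_invertible K.inv U_snd) auto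

lemma invertible_P: "x \<in> U \<Longrightarrow> invertible (P x)"
  unfolding P_def by (intro invertible_block_diag M.inv invertible_K U_fst)

lemma transpose_P: "x \<in> U \<Longrightarrow> transpose (P x) = P x"
  unfolding P_def transpose_block_diag using M.sym[OF U_fst] K.sym[OF U_snd]
  by (simp add: transpose_scalar)

lemma inv_metric_P:
  assumes "x \<in> U"
  shows "inv_metric P x (Inl i) (Inl j) = inv_metric g (fst_coords x) i j"
    "inv_metric P x (Inl i) (Inr b) = 0" "inv_metric P x (Inr a) (Inl j) = 0"
    "inv_metric P x (Inr a) (Inr b) = inv_metric h (snd_coords x) a b / r\<^sup>2"
proof -
  have "matrix_inv (P x) = block_diag (matrix_inv (g (fst_coords x))) ((1 / r\<^sup>2) *\<^sub>R matrix_inv (h (snd_coords x)))"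
    unfolding P_def using assms r_pos
    by (simp add: matrix_inv_block_diag M.inv[OF U_fst] invertible_K matrix_inv_eqI[OF matrix_mult_scaleR_inv] K.inv[OF U_snd])
  thus "inv_metric P x (Inl i) (Inl j) = inv_metric g (fst_coords x) i j"
    "inv_metric P x (Inl i) (Inr b) = 0" "inv_metric P x (Inr a) (Inl j) = 0"
    "inv_metric P x (Inr a) (Inr b) = inv_metric h (snd_coords x) a b / r\<^sup>2"
    by (simp_all add: inv_metric_def)
qed

lemma partial_P:
  assumes "x \<in> U"
  shows "partial (Inl k) (\<lambda>y. P y $ Inl i $ Inl j) x = partial k (\<lambda>y. g y $ i $ j) (fst_coords x)"
    "partial (Inr c) (\<lambda>y. P y $ Inl i $ Inl j) x = 0"
    "partial e (\<lambda>y. P y $ Inl i $ Inr b) x = 0"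
    "partial e (\<lambda>y. P y $ Inr a $ Inl j) x = 0"
    "partial (Inl k) (\<lambda>y. P y $ Inr a $ Inr b) x = 0"
    "partial (Inr c) (\<lambda>y. P y $ Inr a $ Inr b) x = r\<^sup>2 * partial c (\<lambda>y. h y $ a $ b) (snd_coords x)"
proof -
  have "(\<lambda>y. h y $ a $ b) differentiable at (snd_coords x)"
    by (rule K.g_differentiable[OF U_snd[OF assms]])
  moreover from this have "(\<lambda>y. r\<^sup>2 * h y $ a $ b) differentiable at (snd_coords x)" by simp
  ultimately show
    "partial (Inl k) (\<lambda>y. P y $ Inl i $ Inl j) x = partial k (\<lambda>y. g y $ i $ j) (fst_coords x)"
    "partial (Inr c) (\<lambda>y. P y $ Inl i $ Inl j) x = 0"
    "partial e (\<lambda>y. P y $ Inl i $ Inr b) x = 0"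
    "partial e (\<lambda>y. P y $ Inr a $ Inl j) x = 0"
    "partial (Inl k) (\<lambda>y. P y $ Inr a $ Inr b) x = 0"
    "partial (Inr c) (\<lambda>y. P y $ Inr a $ Inr b) x = r\<^sup>2 * partial c (\<lambda>y. h y $ a $ b) (snd_coords x)"
    using partial_fst_coords[OF M.g_differentiable[OF U_fst[OF assms], of i j]]
      partial_snd_coords[of "\<lambda>y. r\<^sup>2 * h y $ a $ b" x]
    by (simp_all add: P_def partial_const partial_mult)
qed

text \<open>Each block of the metric depends on its own coordinates only, so no symbol mixes the
  factors. In the second block the constant \<open>r^2\<close> of the metric cancels against the one
  in its inverse.\<close>

lemma christoffel_P:
  assumes "x \<in> U"
  shows "christoffel P x (Inl i) (Inl j) (Inl k) = christoffel g (fst_coords x) i j k"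
    "christoffel P x (Inr a) (Inr b) (Inr c) = christoffel h (snd_coords x) a b c"
    "christoffel P x (Inl i) (Inl j) (Inr c) = 0" "christoffel P x (Inl i) (Inr b) (Inl k) = 0"
    "christoffel P x (Inl i) (Inr b) (Inr c) = 0" "christoffel P x (Inr a) (Inl j) (Inl k) = 0"
    "christoffel P x (Inr a) (Inl j) (Inr c) = 0" "christoffel P x (Inr a) (Inr b) (Inl k) = 0"
proof -
  show "christoffel P x (Inr a) (Inr b) (Inr c) = christoffel h (snd_coords x) a b c"
    using r_pos unfolding christoffel_def sum_distrib_left
    by (simp add: sum_UNIV_Plus inv_metric_P[OF assms] partial_P[OF assms])
       (intro sum.cong refl, simp add: field_simps)
qed (simp_all add: christoffel_def sum_UNIV_Plus inv_metric_P[OF assms] partial_P[OF assms])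

lemma partial_christoffel_P:
  assumes x: "x \<in> U"
  shows "partial (Inl l) (\<lambda>y. christoffel P y (Inl i) (Inl j) (Inl k)) x
      = partial l (\<lambda>y. christoffel g y i j k) (fst_coords x)"
    "partial (Inr d) (\<lambda>y. christoffel P y (Inl i) (Inl j) (Inl k)) x = 0"
    "partial (Inr d) (\<lambda>y. christoffel P y (Inr a) (Inr b) (Inr c)) x
      = partial d (\<lambda>y. christoffel h y a b c) (snd_coords x)"
    "partial (Inl l) (\<lambda>y. christoffel P y (Inr a) (Inr b) (Inr c)) x = 0"
    "partial e (\<lambda>y. christoffel P y (Inl i) (Inl j) (Inr c)) x = 0"
    "partial e (\<lambda>y. christoffel P y (Inl i) (Inr b) (Inl k)) x = 0"
    "partial e (\<lambda>y. christoffel P y (Inl i) (Inr b) (Inr c)) x = 0"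
    "partial e (\<lambda>y. christoffel P y (Inr a) (Inl j) (Inl k)) x = 0"
    "partial e (\<lambda>y. christoffel P y (Inr a) (Inl j) (Inr c)) x = 0"
    "partial e (\<lambda>y. christoffel P y (Inr a) (Inr b) (Inl k)) x = 0"
proof -
  \<comment> \<open>The formulas for the Christoffel symbols hold only on \<open>U\<close>; since
    \<open>U\<close> is open they may be used under a derivative at \<open>x\<close>.\<close>
  have cong: "partial e f x = partial e f' x" if "\<And>y. y \<in> U \<Longrightarrow> f y = f' y" for e f and f' :: "_ \<Rightarrow> real"
    by (rule partial_cong_open[OF open_U x that])
  note eqs = cong[OF christoffel_P(1)] cong[OF christoffel_P(2)] cong[OF christoffel_P(3)]
    cong[OF christoffel_P(4)] cong[OF christoffel_P(5)] cong[OF christoffel_P(6)]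
    cong[OF christoffel_P(7)] cong[OF christoffel_P(8)]
  note M' = partial_fst_coords[OF M.christoffel_differentiable[OF U_fst[OF x]]]
  note K' = partial_snd_coords[OF K.christoffel_differentiable[OF U_snd[OF x]]]
  show "partial (Inl l) (\<lambda>y. christoffel P y (Inl i) (Inl j) (Inl k)) x
      = partial l (\<lambda>y. christoffel g y i j k) (fst_coords x)"
    "partial (Inr d) (\<lambda>y. christoffel P y (Inl i) (Inl j) (Inl k)) x = 0"
    "partial (Inr d) (\<lambda>y. christoffel P y (Inr a) (Inr b) (Inr c)) x
      = partial d (\<lambda>y. christoffel h y a b c) (snd_coords x)"
    "partial (Inl l) (\<lambda>y. christoffel P y (Inr a) (Inr b) (Inr c)) x = 0"
    "partial e (\<lambda>y. christoffel P y (Inl i) (Inl j) (Inr c)) x = 0"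
    "partial e (\<lambda>y. christoffel P y (Inl i) (Inr b) (Inl k)) x = 0"
    "partial e (\<lambda>y. christoffel P y (Inl i) (Inr b) (Inr c)) x = 0"
    "partial e (\<lambda>y. christoffel P y (Inr a) (Inl j) (Inl k)) x = 0"
    "partial e (\<lambda>y. christoffel P y (Inr a) (Inl j) (Inr c)) x = 0"
    "partial e (\<lambda>y. christoffel P y (Inr a) (Inr b) (Inl k)) x = 0"
    by (simp_all only: eqs M' K' partial_const)
qed

lemma riemann_uddd_P:
  assumes x: "x \<in> U"
  shows "riemann_uddd P x = direct_sum (riemann_uddd g (fst_coords x)) (riemann_uddd h (snd_coords x))"
proof (intro ext)
  fix a b c d
  show "riemann_uddd P x a b c d
      = direct_sum (riemann_uddd g (fst_coords x)) (riemann_uddd h (snd_coords x)) a b c d"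
    by (cases a; cases b; cases c; cases d)
      (simp_all add: direct_sum_def riemann_uddd_def sum_UNIV_Plus christoffel_P[OF x] partial_christoffel_P[OF x])
qed

lemma P_nth: "P x $ Inl i $ Inl j = g (fst_coords x) $ i $ j" "P x $ Inl i $ Inr b = 0"
    "P x $ Inr a $ Inl j = 0" "P x $ Inr a $ Inr b = r\<^sup>2 * h (snd_coords x) $ a $ b"
  by (simp_all add: P_def)

lemma riemann_dddd_P:
  assumes x: "x \<in> U"
  shows "riemann_dddd P x = direct_sum (riemann_dddd g (fst_coords x))
     (\<lambda>a b c d. r\<^sup>2 * riemann_dddd h (snd_coords x) a b c d)"
proof (intro ext)
  fix a b c d
  show "riemann_dddd P x a b c d = direct_sum (riemann_dddd g (fst_coords x))
     (\<lambda>a b c d. r\<^sup>2 * riemann_dddd h (snd_coords x) a b c d) a b c d"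
    by (cases a; cases b; cases c; cases d)
      (simp_all add: riemann_dddd_def riemann_uddd_P[OF x] direct_sum_def P_nth sum_UNIV_Plus
        sum_distrib_left mult.assoc)
qed

text \<open>The tensor with one upper index does not change when the metric is rescaled by a
  constant. Raising the second index with the rescaled inverse metric is what brings in the factor
  \<open>1 / r^2\<close>.\<close>

lemma riemann_mixed_P:
  assumes x: "x \<in> U"
  shows "riemann_mixed P x = direct_sum (riemann_mixed g (fst_coords x))
     (\<lambda>a b c d. riemann_mixed h (snd_coords x) a b c d / r\<^sup>2)"
proof (intro ext)
  fix a b c d
  show "riemann_mixed P x a b c d = direct_sum (riemann_mixed g (fst_coords x))
     (\<lambda>a b c d. riemann_mixed h (snd_coords x) a b c d / r\<^sup>2) a b c d"
    by (cases a; cases b; cases c; cases d)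
      (simp_all add: riemann_mixed_def riemann_uddd_P[OF x] direct_sum_def inv_metric_P[OF x]
        sum_UNIV_Plus sum_divide_distrib)
qed

lemma curvature_point_P:
  assumes x: "x \<in> U"
  shows "curvature_point P x"
proof
  fix a b c d
  show "riemann_dddd P x b a c d = - riemann_dddd P x a b c d"
    unfolding riemann_dddd_P[OF x]
    using M.riemann_dddd_antisym_left[OF U_fst[OF x]] K.riemann_dddd_antisym_left[OF U_snd[OF x]]
    by (intro direct_sum_antisym) (metis mult_minus_right)+
  show "riemann_dddd P x a b c d = riemann_dddd P x c d a b"
    unfolding riemann_dddd_P[OF x]
    using M.riemann_dddd_pair_sym[OF U_fst[OF x]] K.riemann_dddd_pair_sym[OF U_snd[OF x]]
    by (intro direct_sum_pair_sym) metis+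
qed (intro invertible_P transpose_P x)+

end

section \<open>Constant sectional curvature\<close>

text \<open>Passing from components to a quadrilinear form makes polarisation available: the
  numerator of \<open>sectional_curv\<close> is the value at \<open>u v u v\<close>, and basis
  vectors give the components back.\<close>

definition tensor_form :: "('d::finite \<Rightarrow> 'd \<Rightarrow> 'd \<Rightarrow> 'd \<Rightarrow> real) \<Rightarrow> real^'d \<Rightarrow> real^'d \<Rightarrow> real^'d \<Rightarrow> real^'d \<Rightarrow> real" where
  "tensor_form T u v w z = (\<Sum>a\<in>UNIV. \<Sum>b\<in>UNIV. \<Sum>c\<in>UNIV. \<Sum>d\<in>UNIV. T a b c d * u $ a * v $ b * w $ c * z $ d)"

lemma tensor_form_add:
  "tensor_form T (u + u') v w z = tensor_form T u v w z + tensor_form T u' v w z"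
  "tensor_form T u (v + v') w z = tensor_form T u v w z + tensor_form T u v' w z"
  "tensor_form T u v (w + w') z = tensor_form T u v w z + tensor_form T u v w' z"
  "tensor_form T u v w (z + z') = tensor_form T u v w z + tensor_form T u v w z'"
  by (simp_all add: tensor_form_def distrib_left distrib_right sum.distrib)

lemma tensor_form_scale: "tensor_form T (s *\<^sub>R v) v (s *\<^sub>R v) v = s\<^sup>2 * tensor_form T v v v v"
  by (simp add: tensor_form_def sum_distrib_left power2_eq_square mult_ac)

lemma tensor_form_zero: "tensor_form T u 0 w z = 0"
  by (simp add: tensor_form_def)

lemma tensor_form_axis: "tensor_form T (axis a 1) (axis b 1) (axis c 1) (axis d 1) = T a b c d"
proof -
  have ax: "(\<Sum>e\<in>UNIV. f e * axis i 1 $ e) = f i" for f :: "'a \<Rightarrow> real" and i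
    by (simp add: axis_def if_distrib[of "\<lambda>x. _ * x"] cong: if_cong)
  have "tensor_form T (axis a 1) (axis b 1) (axis c 1) (axis d 1)
    = (\<Sum>a'\<in>UNIV. (\<Sum>b'\<in>UNIV. (\<Sum>c'\<in>UNIV. (\<Sum>d'\<in>UNIV. T a' b' c' d' * axis d 1 $ d') * axis c 1 $ c')
        * axis b 1 $ b') * axis a 1 $ a')"
    unfolding tensor_form_def sum_distrib_right by (simp add: mult_ac)
  thus ?thesis unfolding ax .
qed

lemma tensor_form_antisym:
  assumes "\<And>a b c d. T b a c d = - T a b c d"
  shows "tensor_form T v v w z = 0"
proof -
  have "tensor_form T v v w z
    = (\<Sum>b\<in>UNIV. \<Sum>a\<in>UNIV. \<Sum>c\<in>UNIV. \<Sum>d\<in>UNIV. T a b c d * v $ a * v $ b * w $ c * z $ d)"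
    unfolding tensor_form_def by (rule sum.swap)
  also have "\<dots> = - tensor_form T v v w z"
    unfolding tensor_form_def by (subst assms) (simp add: sum_negf mult_ac)
  finally show ?thesis by simp
qed

lemma tensor_form_product:
  "tensor_form (\<lambda>a b c d. A $ a $ c * B $ b $ d) u v w z = (u \<bullet> (A *v w)) * (v \<bullet> (B *v z))"
proof -
  have "p \<bullet> (C *v q) = (\<Sum>i\<in>UNIV. \<Sum>j\<in>UNIV. p $ i * (C $ i $ j * q $ j))" for p q and C :: "real^'a^'a"
    by (simp add: inner_vec_def matrix_vector_mult_def sum_distrib_left)
  thus ?thesis by (simp only: tensor_form_def sum_product mult_ac)
qed

lemma tensor_form_product':
  "tensor_form (\<lambda>a b c d. A $ a $ d * B $ b $ c) u v w z = (u \<bullet> (A *v z)) * (v \<bullet> (B *v w))"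
proof -
  have "tensor_form (\<lambda>a b c d. A $ a $ d * B $ b $ c) u v w z
      = tensor_form (\<lambda>a b c d. A $ a $ c * B $ b $ d) u v z w"
    unfolding tensor_form_def
    by (rule sum.cong[OF refl], rule sum.cong[OF refl], subst sum.swap) (simp add: mult_ac)
  thus ?thesis unfolding tensor_form_product .
qed

lemma tensor_form_diff_scale:
  "tensor_form (\<lambda>a b c d. T a b c d - k * (T' a b c d - T'' a b c d)) u v w z
    = tensor_form T u v w z - k * (tensor_form T' u v w z - tensor_form T'' u v w z)"
  unfolding tensor_form_def sum_distrib_left sum_subtractf[symmetric]
  by (simp add: algebra_simps)

text \<open>Polarisation of \<open>quad\<close>: inserting sums of basis vectors shows in turn that
  components with equal first and third or equal second and fourth index vanish, and that
  \<open>T\<close> changes sign when its second and fourth index are exchanged. Together with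
  \<open>right\<close>, this makes the three terms of the cyclic identity equal, so each is
  zero.\<close>

lemma curvature_tensor_eq_0:
  assumes left: "\<And>a b c d. T b a c d = - T a b c d"
    and right: "\<And>a b c d. T a b d c = - T a b c d"
    and pair: "\<And>a b c d. T a b c d = T c d a b"
    and bianchi: "\<And>a b c d. T a b c d + T a c d b + T a d b c = 0"
    and quad: "\<And>u v. tensor_form T u v u v = 0"
  shows "T a b c d = 0"
proof -
  have e2: "T a b a b = 0" for a b
    using quad[of "axis a 1" "axis b 1"] by (simp add: tensor_form_axis)
  have e3: "T a b a d = 0" for a b d
    using quad[of "axis a 1" "axis b 1 + axis d 1"] pair[of a b a d]
    by (simp add: tensor_form_axis tensor_form_add e2)
  have e3': "T b a d a = 0" for a b d
    using left[of b a d a] right[of a b d a] e3[of a b d] by linarith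
  have e4: "T a d c b = - T a b c d" for a b c d
    using quad[of "axis a 1 + axis c 1" "axis b 1 + axis d 1"] pair[of a b c d] pair[of a d c b]
    by (simp add: tensor_form_axis tensor_form_add e2 e3 e3')
  show ?thesis
    using bianchi[of a b c d] e4[of a c d b] right[of a b d c] e4[of a d b c] right[of a c d b]
    by linarith
qed

lemma inner_matrix_sym:
  fixes A :: "real^'n^'n"
  assumes "transpose A = A"
  shows "u \<bullet> (A *v v) = v \<bullet> (A *v u)"
  by (metis assms dot_lmul_matrix inner_commute transpose_matrix_vector)

context metric_chart
begin

text \<open>The difference between the Riemann tensor and the model has all symmetries of a
  curvature tensor, so it is enough that its form vanishes at \<open>u v u v\<close>. For linearly
  independent \<open>u\<close>, \<open>v\<close> this is the assumption on sectional curvature,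
  where positivity keeps the denominator away from zero.\<close>

lemma riemann_dddd_const_curv:
  assumes x: "x \<in> S"
    and pos: "\<And>v. v \<noteq> 0 \<Longrightarrow> v \<bullet> (g x *v v) > 0"
    and sec: "\<And>u v. u \<noteq> v \<Longrightarrow> independent {u, v} \<Longrightarrow> sectional_curv g x u v = k"
  shows "riemann_dddd g x a b c d = k * (g x $ a $ c * g x $ b $ d - g x $ a $ d * g x $ b $ c)"
proof -
  define T where "T = (\<lambda>a b c d. riemann_dddd g x a b c d
     - k * (g x $ a $ c * g x $ b $ d - g x $ a $ d * g x $ b $ c))"
  define B where "B u v = u \<bullet> (g x *v v)" for u v
  have B_sym: "B u v = B v u" for u v
    unfolding B_def by (rule inner_matrix_sym[OF sym[OF x]])
  have left: "T b a c d = - T a b c d" for a b c d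
    unfolding T_def riemann_dddd_antisym_left[OF x, of b a] by (simp add: algebra_simps)
  have right: "T a b d c = - T a b c d" for a b c d
    unfolding T_def riemann_dddd_antisym_right[of g x a b d c] by (simp add: algebra_simps)
  have pair: "T a b c d = T c d a b" for a b c d
    unfolding T_def riemann_dddd_pair_sym[OF x, of a b c d]
    by (simp add: g_sym[OF x, of c a] g_sym[OF x, of d b] g_sym[OF x, of c b] g_sym[OF x, of d a] mult_ac)
  have bianchi: "T a b c d + T a c d b + T a d b c = 0" for a b c d
    unfolding T_def using riemann_dddd_bianchi[OF x, of a b c d]
    by (simp add: g_sym[OF x, of c b] g_sym[OF x, of d b] g_sym[OF x, of d c] algebra_simps)
  have T_form: "tensor_form T u v u v
      = tensor_form (riemann_dddd g x) u v u v - k * (B u u * B v v - (B u v)\<^sup>2)" for u v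
    unfolding T_def tensor_form_diff_scale tensor_form_product tensor_form_product'
    unfolding B_def[symmetric] using B_sym[of v u] by (simp add: power2_eq_square)
  have quad: "tensor_form T u v u v = 0" for u v
  \<comment> \<open>The first case is exactly linear dependence, \<open>u = 0\<close> being covered
    by \<open>s = 0\<close>; there antisymmetry makes the form vanish.\<close>
  proof (cases "v = 0 \<or> (\<exists>s. u = s *\<^sub>R v)")
    case True
    thus ?thesis
      using tensor_form_scale[of T _ v] tensor_form_antisym[of T v v v, OF left]
      by (auto simp: tensor_form_zero)
  next
    case False
    hence "v \<noteq> 0" and span: "u \<notin> span {v}" by (auto simp: span_singleton)
    hence uv: "u \<noteq> v" using span_base by blast
    have ind: "independent {u, v}"
      using \<open>v \<noteq> 0\<close> span uv by (simp add: independent_insert)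
    \<comment> \<open>\<open>w\<close> is \<open>B v v\<close> times the part of \<open>u\<close>
      orthogonal to \<open>v\<close>. Its square under \<open>B\<close> is \<open>B v v\<close>
      times the Gram determinant of \<open>u\<close> and \<open>v\<close>, which is therefore
      nonzero.\<close>
    define w where "w = B v v *\<^sub>R u - B u v *\<^sub>R v"
    have Bv: "B v v > 0" using pos[OF \<open>v \<noteq> 0\<close>] by (simp add: B_def)
    have "w \<noteq> 0"
    proof
      assume "w = 0"
      hence "B v v *\<^sub>R u = B u v *\<^sub>R v" by (simp add: w_def)
      hence "(1 / B v v) *\<^sub>R (B v v *\<^sub>R u) = (1 / B v v) *\<^sub>R (B u v *\<^sub>R v)" by simp
      hence "u = (B u v / B v v) *\<^sub>R v" using Bv by simp
      thus False using False by blast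
    qed
    hence "B w w > 0" using pos by (simp add: B_def)
    moreover have "B w w = B v v * (B u u * B v v - (B u v)\<^sup>2)"
    proof -
      have "B w w = B v v * (B v v * B u u) - B v v * (B u v * B u v) - B u v * (B v v * B v u) + B u v * (B u v * B v v)"
        unfolding w_def B_def
        by (simp add: matrix_vector_mult_diff_distrib matrix_vector_mult_scaleR inner_diff_left inner_diff_right algebra_simps)
      thus ?thesis using B_sym[of v u] by (simp add: power2_eq_square algebra_simps)
    qed
    ultimately have "B u u * B v v - (B u v)\<^sup>2 \<noteq> 0" by auto
    moreover have "tensor_form (riemann_dddd g x) u v u v / (B u u * B v v - (B u v)\<^sup>2) = k"
      using sec[OF uv ind] unfolding sectional_curv_def tensor_form_def B_def .
    ultimately show ?thesis unfolding T_form by (simp add: field_simps)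
  qed
  show ?thesis
    using curvature_tensor_eq_0[of T a b c d, OF left right pair bianchi quad] by (simp add: T_def)
qed

lemma curvature_point: "x \<in> S \<Longrightarrow> curvature_point g x"
  by unfold_locales (auto intro: inv sym riemann_dddd_antisym_left riemann_dddd_pair_sym)

text \<open>Raising the first two indices turns every metric factor of
  \<open>riemann_dddd_const_curv\<close> into a Kronecker delta.\<close>

lemma riemann_mixed_const_curv:
  assumes x: "x \<in> S"
    and pos: "\<And>v. v \<noteq> 0 \<Longrightarrow> v \<bullet> (g x *v v) > 0"
    and sec: "\<And>u v. u \<noteq> v \<Longrightarrow> independent {u, v} \<Longrightarrow> sectional_curv g x u v = k"
  shows "riemann_mixed g x = const_curv k"
proof (intro ext)
  fix a b c d
  interpret C: curvature_point g x by (rule curvature_point[OF x])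
  have delta: "(\<Sum>p\<in>UNIV. inv_metric g x a p * g x $ p $ c) = of_bool (a = c)" for a c
    using inv_metric_left[of g x a c, OF inv[OF x]] by simp
  have "riemann_mixed g x a b c d = (\<Sum>q\<in>UNIV. \<Sum>p\<in>UNIV. inv_metric g x a p * inv_metric g x b q *
     (k * (g x $ p $ c * g x $ q $ d - g x $ p $ d * g x $ q $ c)))"
    unfolding C.riemann_mixed_eq using riemann_dddd_const_curv[OF x pos sec] by simp
  also have "\<dots> = k * ((\<Sum>q\<in>UNIV. inv_metric g x b q * g x $ q $ d) * (\<Sum>p\<in>UNIV. inv_metric g x a p * g x $ p $ c)
     - (\<Sum>q\<in>UNIV. inv_metric g x b q * g x $ q $ c) * (\<Sum>p\<in>UNIV. inv_metric g x a p * g x $ p $ d))"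
    unfolding sum_product unfolding sum_subtractf[symmetric] unfolding sum_distrib_left
    by (intro sum.cong refl) (simp add: algebra_simps)
  finally show "riemann_mixed g x a b c d = const_curv k a b c d"
    unfolding delta by (simp add: const_curv_def)
qed

end

section \<open>Nondegeneracy of the two metrics\<close>

lemma lorentzian_form_invertible:
  fixes h :: "real^'d^'d::finite"
  assumes "lorentzian_form h"
  shows "invertible h"
proof -
  obtain e :: "'d \<Rightarrow> real^'d" and t where
    e: "\<And>i j. e i \<bullet> (h *v e j) = (if i = j then (if i = t then - 1 else 1) else 0)"
    using assms unfolding lorentzian_form_def by blast
  \<comment> \<open>With the orthonormal basis as columns, \<open>transpose E ** (h ** E)\<close> is
    diagonal with entries 1 and -1. Its determinant is nonzero, and \<open>det h\<close> is a factor
    of it.\<close>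
  define E :: "real^'d^'d" where "E = (\<chi> i j. e j $ i)"
  have "(transpose E ** (h ** E)) $ i $ j = e i \<bullet> (h *v e j)" for i j
    unfolding E_def inner_vec_def matrix_matrix_mult_def matrix_vector_mult_def transpose_def by simp
  hence comp: "(transpose E ** (h ** E)) $ i $ j = (if i = j then (if i = t then - 1 else 1) else 0)" for i j
    using e by simp
  have "det (transpose E ** (h ** E)) = (\<Prod>i\<in>UNIV. (transpose E ** (h ** E)) $ i $ i)"
    by (rule det_diagonal) (simp add: comp)
  also have "\<dots> \<noteq> 0" by (simp add: comp)
  finally show ?thesis by (auto simp: det_mul invertible_det_nz)
qed

lemma positive_form_invertible:
  fixes h :: "real^'d^'d::finite"
  assumes "\<And>v. v \<noteq> 0 \<Longrightarrow> v \<bullet> (h *v v) > 0"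
  shows "invertible h"
proof -
  have "v = 0" if "h *v v = 0" for v
    using assms[of v] that by fastforce
  thus ?thesis by (simp add: invertible_left_inverse matrix_left_invertible_ker)
qed

lemma symmetric_tensor_field_metric_chart:
  fixes M :: "('i, 'm, 'd::finite) metric_manifold"
  assumes "smooth_manifold M" "symmetric_tensor_field M" "i \<in> charts M"
    and "\<And>x. x \<in> cimage M i \<Longrightarrow> invertible (gmat M i x)"
  shows "metric_chart (gmat M i) (cimage M i)"
  using assms unfolding metric_chart_def smooth_manifold_def symmetric_tensor_field_def smooth_on_def
  by blast

section \<open>Evaluation of the field equations on the product\<close>

theorem theorem1:
  fixes n :: nat and \<alpha> \<Lambda> r0 k :: real
    and M :: "('i, 'm, 4) metric_manifold"
    and K :: "('j, 'k, 'd::finite) metric_manifold"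
  assumes "n \<ge> 6" and "CARD('d) = n - 4"
    and "\<alpha> \<ge> 0" and "\<Lambda> \<noteq> 0" and "r0 > 0" and "k \<in> {1, - 1}"
    and "lorentzian_manifold M"
    and "riemannian_manifold K" and "constant_sectional_curvature K k"
    and "r0\<^sup>2 = - 2 * k * \<alpha> * (real n - 4) * (real n - 5)"
    and "\<alpha> * \<Lambda> = - (((real n)\<^sup>2 - 5 * real n - 2) / (8 * (real n - 4) * (real n - 5)))"
  shows "\<forall>c\<in>charts (product_manifold r0 M K). \<forall>p\<in>cdom (product_manifold r0 M K) c.
           \<forall>A B :: 4. egb_tensor \<alpha> \<Lambda> (product_manifold r0 M K) c p (Inl A) (Inl B) = 0"
proof (intro ballI allI)
  fix c p and A B :: 4
  assume c: "c \<in> charts (product_manifold r0 M K)" and p: "p \<in> cdom (product_manifold r0 M K) c"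
  obtain i j p1 p2 where cp: "c = (i, j)" "p = (p1, p2)" by (metis surj_pair)
  have ij: "i \<in> charts M" "j \<in> charts K" and p12: "p1 \<in> cdom M i" "p2 \<in> cdom K j"
    using c p by (auto simp: cp product_manifold_def)
  interpret M: metric_chart "gmat M i" "cimage M i"
    using assms(7) ij unfolding lorentzian_manifold_def
    by (intro symmetric_tensor_field_metric_chart) (auto intro: lorentzian_form_invertible)
  have K_pos: "v \<bullet> (gmat K j y *v v) > 0" if "y \<in> cimage K j" "v \<noteq> 0" for y v
    using assms(8) ij that unfolding riemannian_manifold_def by blast
  interpret K: metric_chart "gmat K j" "cimage K j"
    using assms(8) ij unfolding riemannian_manifold_def
    by (intro symmetric_tensor_field_metric_chart) (auto intro: positive_form_invertible)
  interpret Q: product_chart "gmat M i" "cimage M i" "gmat K j" "cimage K j" r0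
    by unfold_locales (rule assms(5))
  define x where "x = coord (product_manifold r0 M K) c p"
  have x1: "fst_coords x = coord M i p1" and x2: "snd_coords x = coord K j p2"
    by (simp_all add: x_def cp product_manifold_def fst_coords_def snd_coords_def vec_eq_iff)
  have "fst_coords x \<in> cimage M i" "snd_coords x \<in> cimage K j"
    using p12 by (simp_all add: x1 x2 cimage_def)
  hence x: "x \<in> Q.U" by (simp add: Q.U_def)
  have "gmat (product_manifold r0 M K) c = Q.P"
    by (auto simp: fun_eq_iff vec_eq_iff cp product_manifold_def Q.P_def block_diag_def
        fst_coords_def snd_coords_def split: sum.split)
  hence egb: "egb_tensor \<alpha> \<Lambda> (product_manifold r0 M K) c p (Inl A) (Inl B)
      = egb_ud \<alpha> \<Lambda> Q.P x (Inl A) (Inl B)"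
    by (simp add: egb_tensor_def x_def)
  interpret C: curvature_point Q.P x by (rule Q.curvature_point_P[OF x])
  interpret CM: curvature_point "gmat M i" "fst_coords x"
    by (rule M.curvature_point[OF Q.U_fst[OF x]])
  define X where "X = riemann_mixed (gmat M i) (fst_coords x)"
  define \<kappa> where "\<kappa> = k / r0\<^sup>2"
  have scaled: "(\<lambda>a b c d. const_curv k a b c d / r0\<^sup>2) = (const_curv \<kappa> :: 'd \<Rightarrow> _)"
    by (simp add: const_curv_def fun_eq_iff \<kappa>_def)
  have "riemann_mixed (gmat K j) (snd_coords x) = const_curv k"
    using assms(9) ij Q.U_snd[OF x]
    by (intro K.riemann_mixed_const_curv K_pos) (auto simp: constant_sectional_curvature_def)
  hence mixed: "riemann_mixed Q.P x = direct_sum X (const_curv \<kappa> :: 'd \<Rightarrow> _)"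
    unfolding Q.riemann_mixed_P[OF x] X_def by (simp add: scaled)
  have X0: "gb_tensor X A B = 0"
    unfolding X_def
    by (rule gb_tensor_dim4) (rule CM.riemann_mixed_antisym_left, rule riemann_mixed_antisym_right)
  define d where "d = real CARD('d)"
  have nd: "real n = d + 4" "d \<ge> 2" using assms(1,2) by (auto simp: d_def)
  define s where "s = scal (const_curv \<kappa> :: 'd \<Rightarrow> _)"
  \<comment> \<open>If \<alpha> were zero, condition (i) would give \<open>r0^2 = 0\<close>.\<close>
  have \<alpha>: "\<alpha> \<noteq> 0" using assms(5,10) by auto
  have k2: "k\<^sup>2 = 1" using assms(6) by auto
  have r: "r0\<^sup>2 = - 2 * k * \<alpha> * (d * (d - 1))" using assms(10) nd by simp
  have "k \<noteq> 0" using k2 by auto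
  \<comment> \<open>Putting condition (i) into \<open>\<kappa> = k / r0^2\<close> cancels
    \<open>k\<close>, so both signs of the curvature are treated alike. The division needs
    \<open>d * (d - 1)\<close> to be nonzero, which follows from \<open>d \<ge> 2\<close>.\<close>
  hence \<kappa>: "2 * \<alpha> * \<kappa> * (d * (d - 1)) = - 1"
    using nd \<alpha> unfolding \<kappa>_def r by (simp add: divide_simps)
  have s: "2 * \<alpha> * s = - 1" using \<kappa> by (simp add: s_def scal_const_curv d_def mult_ac)
  have L: "gb_scalar (const_curv \<kappa> :: 'd \<Rightarrow> _) = \<kappa>\<^sup>2 * d * (d - 1) * (d - 2) * (d - 3)"
    by (simp add: gb_scalar_const_curv d_def)
  \<comment> \<open>Condition (ii) rewritten with \<open>n = d + 4\<close> and cleared of its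
    denominator.\<close>
  have \<Lambda>: "8 * (d * (d - 1)) * (\<alpha> * \<Lambda>) = - (d\<^sup>2 + 3 * d - 6)"
  proof -
    have "8 * (real n - 4) * (real n - 5) = 8 * (d * (d - 1))"
      and "(real n)\<^sup>2 - 5 * real n - 2 = d\<^sup>2 + 3 * d - 6"
      by (simp_all add: nd(1) power2_eq_square algebra_simps)
    thus ?thesis using nd(2) unfolding assms(11) by simp
  qed
  have zero: "\<Lambda> - s / 2 - \<alpha> / 2 * gb_scalar (const_curv \<kappa> :: 'd \<Rightarrow> _) = 0"
  proof -
    \<comment> \<open>Multiplying by the nonzero \<open>8 * (d * (d - 1)) * \<alpha>\<close> groups
      everything into the three quantities known from \<open>\<Lambda>\<close>, \<open>s\<close> and
      \<open>\<kappa>\<close>. What is left is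
      \<open>- (d^2 + 3 d - 6) + 2 d (d - 1) - (d - 2) (d - 3)\<close>, which is zero.\<close>
    have "8 * (d * (d - 1)) * \<alpha> * (\<Lambda> - s / 2 - \<alpha> / 2 * gb_scalar (const_curv \<kappa> :: 'd \<Rightarrow> _))
      = 8 * (d * (d - 1)) * (\<alpha> * \<Lambda>) - 2 * (d * (d - 1)) * (2 * \<alpha> * s)
        - (2 * \<alpha> * \<kappa> * (d * (d - 1)))\<^sup>2 * ((d - 2) * (d - 3))"
      unfolding L by algebra
    also have "\<dots> = 0" unfolding \<Lambda> s \<kappa> by algebra
    finally show ?thesis using nd(2) \<alpha> by simp
  qed
  \<comment> \<open>The Einstein tensor of \<open>M\<close> collects the coefficient
    \<open>1 + 2 * \<alpha> * s\<close>: the 1 comes from the Einstein term and the rest from the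
    cross terms of the Gauss-Bonnet tensor. Both this coefficient and that of the delta are zero by
    \<open>s\<close> and \<open>zero\<close>.\<close>
  have "egb_ud \<alpha> \<Lambda> Q.P x (Inl A) (Inl B) = (1 + 2 * \<alpha> * s) * contr X A B
     - (1/2) * (1 + 2 * \<alpha> * s) * scal X * of_bool (A = B)
     + (\<Lambda> - s / 2 - \<alpha> / 2 * gb_scalar (const_curv \<kappa> :: 'd \<Rightarrow> _)) * of_bool (A = B)"
    unfolding C.egb_ud_eq mixed gb_tensor_direct_sum X0 scal_direct_sum contr_direct_sum s_def[symmetric]
    by (simp add: algebra_simps)
  also have "\<dots> = 0" unfolding zero s by simp
  finally show "egb_tensor \<alpha> \<Lambda> (product_manifold r0 M K) c p (Inl A) (Inl B) = 0"
    unfolding egb .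
qed

end
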